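(* Let $(\Omega,\mathcal{A},\pi)$ be a probability space and $\mathcal{I}\subseteq\mathcal{A}$ a system of measurable sets with $\chi(\mathcal{I})<\infty$. Then \[ \inf_{\mathrm{VP}(\mathcal{I})}\varphi_\pi = \min_{\overline{\mathrm{VP}}(\mathcal{I})}\varphi_\pi = \varphi_\pi(a) \] for an a.e.\ unique $a\in\overline{\mathrm{VP}}(\mathcal{I})$ (in particular the minimum over $\overline{\mathrm{VP}}(\mathcal{I})$ is attained). If moreover $1/a\in L_2(\pi)$ for this $a$, then for all $0<\lambda<1$, \[ \underline{H}_\lambda(\mathcal{I},\pi)=\overline{H}_\lambda(\mathcal{I},\pi)=\varphi_\pi(a)=\int_\Omega -\log(a(x))\,\mathrm{d}\pi(x), \] i.e.\ the entropy $H(\mathcal{I},\pi)$ exists and equals $\varphi_\pi(a)$.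
   Context: $\chi(\mathcal{I})$ is the smallest positive integer $r$ such that there are $J_1,\dots,J_r\in\mathcal{I}$ with $\pi(\bigcup_k J_k)=1$ ($\infty$ if none exists). For measurable $a:\Omega\to[0,\infty)$, $\varphi_\pi(a)=\int_\Omega-\log(a(x))\,\mathrm{d}\pi(x)$ with $-\log0=\infty$. $\mathrm{VP}(\mathcal{I})$ is the set of finite convex combinations $\sum_k q_k\mathbf{1}_{J_k}$ with $J_k\in\mathcal{I}$, $q_k\ge0$, $\sum q_k=1$, and $\overline{\mathrm{VP}}(\mathcal{I})$ is its closure in $L_1(\pi)$. An $\ell$-dimensional $\mathcal{I}$-box is a product $J_1\times\cdots\times J_\ell$ with $J_i\in\mathcal{I}$; $N_\ell(\mathcal{I},\pi,\lambda)$ is the minimum number of such boxes whose union has $\pi^\ell$-measure at least $1-\lambda$; $\underline{H}_\lambda(\mathcal{I},\pi)=\liminf_{\ell}\frac1\ell\log N_\ell(\mathcal{I},\pi,\lambda)$, $\overline{H}_\lambda(\mathcal{I},\pi)=\limsup_{\ell}\frac1\ell\log N_\ell(\mathcal{I},\pi,\lambda)$. The entropy $H(\mathcal{I},\pi)$ exists and equals $h$ if $\underline{H}_\lambda=\overline{H}_\lambda=h$ for all $0<\lambda<1$. *)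

theory Defs
  imports "HOL-Probability.Probability"
begin

text \<open>
  A probability space \<open>(\<Omega>, \<A>, \<pi>)\<close> is a measure \<open>M\<close> with \<open>prob_space M\<close>; a system of measurable
  sets is some \<open>I \<subseteq> sets M\<close>.
\<close>

definition cover_number :: "'a measure \<Rightarrow> 'a set set \<Rightarrow> enat" where
  "cover_number M I =
     Inf (enat ` {r. 0 < r \<and> (\<exists>J::nat \<Rightarrow> 'a set.
            (\<forall>k<r. J k \<in> I) \<and> measure M (\<Union>k<r. J k) = 1)})"

text \<open>
  Natural logarithm with values in the extended reals, \<open>log 0 = -\<infinity>\<close> and \<open>log \<infinity> = \<infinity>\<close>. Negative
  arguments are off-domain; they are treated like \<open>0\<close>.
\<close>

definition ext_ln :: "ereal \<Rightarrow> ereal" where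
  "ext_ln x = (if x \<le> 0 then - \<infinity> else if x = \<infinity> then \<infinity> else ereal (ln (real_of_ereal x)))"

text \<open>
  The integral of \<open>- log a\<close> in the extended sense, i.e. integral of the positive part minus integral
  of the negative part; \<open>e2ennreal\<close> truncates negative values to \<open>0\<close>, so it computes these parts.
  (For \<open>a \<le> 1\<close> a.e., as for all \<open>a\<close> in \<open>VP_closure\<close>, the negative part vanishes.)
\<close>

definition phi :: "'a measure \<Rightarrow> ('a \<Rightarrow> real) \<Rightarrow> ereal" where
  "phi M a =
     enn2ereal (\<integral>\<^sup>+ x. e2ennreal (- ext_ln (ereal (a x))) \<partial>M)
   - enn2ereal (\<integral>\<^sup>+ x. e2ennreal (ext_ln (ereal (a x))) \<partial>M)"

definition VP :: "'a set set \<Rightarrow> ('a \<Rightarrow> real) set" where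
  "VP I = {f. \<exists>(n::nat) (q::nat \<Rightarrow> real) (J::nat \<Rightarrow> 'a set).
             (\<forall>k<n. J k \<in> I \<and> 0 \<le> q k) \<and> (\<Sum>k<n. q k) = 1 \<and>
             f = (\<lambda>x. \<Sum>k<n. q k * indicator (J k) x)}"

text \<open>
  The closure in \<open>L\<^sub>1(\<pi>)\<close>, given by all representatives of its elements. Such a representative is
  nonnegative almost everywhere, but may take arbitrary values on a null set.
\<close>

definition VP_closure :: "'a measure \<Rightarrow> 'a set set \<Rightarrow> ('a \<Rightarrow> real) set" where
  "VP_closure M I = {a. integrable M a \<and>
             (\<forall>e>0. \<exists>f\<in>VP I. (\<integral>x. \<bar>a x - f x\<bar> \<partial>M) < e)}"

text \<open>Points of \<open>\<Omega>\<^sup>l\<close> are the extensional functions on \<open>{..<l}\<close>.\<close>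

definition boxes :: "nat \<Rightarrow> 'a set set \<Rightarrow> (nat \<Rightarrow> 'a) set set" where
  "boxes l I = {Pi\<^sub>E {..<l} J | J. \<forall>i<l. J i \<in> I}"

definition box_cover_number :: "nat \<Rightarrow> 'a set set \<Rightarrow> 'a measure \<Rightarrow> real \<Rightarrow> enat" where
  "box_cover_number l I M lam =
     Inf {enat (card B) | B. finite B \<and> B \<subseteq> boxes l I \<and>
            measure (Pi\<^sub>M {..<l} (\<lambda>_. M)) (\<Union>B) \<ge> 1 - lam}"

definition lower_entropy :: "real \<Rightarrow> 'a set set \<Rightarrow> 'a measure \<Rightarrow> ereal" where
  "lower_entropy lam I M =
     liminf (\<lambda>l. ereal (1 / real l) * ext_ln (ereal_of_enat (box_cover_number l I M lam)))"

definition upper_entropy :: "real \<Rightarrow> 'a set set \<Rightarrow> 'a measure \<Rightarrow> ereal" where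
  "upper_entropy lam I M =
     limsup (\<lambda>l. ereal (1 / real l) * ext_ln (ereal_of_enat (box_cover_number l I M lam)))"

definition has_entropy :: "'a set set \<Rightarrow> 'a measure \<Rightarrow> ereal \<Rightarrow> bool" where
  "has_entropy I M h \<longleftrightarrow>
     (\<forall>lam. 0 < lam \<and> lam < 1 \<longrightarrow> lower_entropy lam I M = h \<and> upper_entropy lam I M = h)"

text \<open>
  \<open>1/a \<in> L\<^sub>2(\<pi>)\<close>. The reciprocal is taken in the extended nonnegative reals, where \<open>1/0 = \<infinity>\<close>, so
  that the condition forces \<open>a > 0\<close> a.e.; with \<open>1/0 = 0\<close> in the reals it would not.
\<close>

definition reciprocal_in_L2 :: "'a measure \<Rightarrow> ('a \<Rightarrow> real) \<Rightarrow> bool" where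
  "reciprocal_in_L2 M a \<longleftrightarrow>
     a \<in> borel_measurable M \<and> (\<integral>\<^sup>+ x. (1 / ennreal (a x))\<^sup>2 \<partial>M) < \<infinity>"

end

theory Submission
  imports Defs "HOL-Real_Asymp.Real_Asymp"
begin

text \<open>
  Maximise \<open>\<integral> ln f\<close> over \<open>VP I\<close>. On \<open>(0, 1]\<close> the logarithm is strongly concave, so a maximising
  sequence is Cauchy in \<open>L\<^sub>1\<close>; Fatou's lemma shows that its limit \<open>a\<close> attains the supremum, and strong
  concavity gives uniqueness. Finiteness of the cover number provides \<open>u \<in> VP I\<close> bounded below by a
  positive constant, and mixing with \<open>u\<close> shows that passing to the closure does not increase the
  supremum.

  Upper bound on the entropy: choose \<open>f \<in> VP I\<close> bounded below with \<open>\<integral> ln f\<close> almost maximal. A random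
  box drawn factorwise from the weights of \<open>f\<close> contains \<open>x\<close> with probability \<open>\<Prod>i. f (x i)\<close>, which is
  about \<open>exp (- l \<phi>(a))\<close> for typical \<open>x\<close> by the law of large numbers, so about \<open>exp (l \<phi>(a))\<close> greedily
  chosen boxes suffice.

  Lower bound: optimality of \<open>a\<close> yields \<open>\<integral>\<^sub>J 1/a \<le> 1\<close> for all \<open>J \<in> I\<close>. Hence \<open>\<Prod>i. 1 / a (x i)\<close> has
  integral at most \<open>1\<close> over every box, while it is about \<open>exp (l \<phi>(a))\<close> at typical points. Replacing
  \<open>1/a\<close> by the bounded function \<open>(1 - t) / (a + t)\<close> makes Hoeffding's inequality applicable.
\<close>

section \<open>Product spaces and boxes\<close>

lemma (in prob_space) indep_vars_PiM_coordinates: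
  assumes "finite K" "K \<noteq> {}"
  shows "prob_space.indep_vars (PiM K (\<lambda>_. M)) (\<lambda>_. M) (\<lambda>i x. x i) K"
proof -
  interpret P: prob_space "PiM K (\<lambda>_. M)"
    by (intro prob_space_PiM prob_space_axioms)
  \<comment> \<open>The joint map of the coordinates is restriction to \<open>K\<close>, which is
    the identity on extensional functions. So the joint law is the product measure itself, that is,
    the product of the coordinate laws.\<close>
  have "distr (PiM K (\<lambda>_. M)) (PiM K (\<lambda>_. M)) (\<lambda>x. \<lambda>i\<in>K. x i) = PiM K (\<lambda>_. M)"
    by (subst distr_cong[OF refl refl, where g = "\<lambda>x. x"])
       (auto simp: space_PiM PiE_def extensional_restrict distr_id)
  also have "\<dots> = PiM K (\<lambda>i. distr (PiM K (\<lambda>_. M)) M (\<lambda>x. x i))"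
    by (intro PiM_cong refl sym[OF distr_PiM_component] prob_space_axioms)
  finally show ?thesis
    using assms by (subst P.indep_vars_iff_distr_eq_PiM') auto
qed

text \<open>Hoeffding's inequality bounds the tail by \<open>exp (- c * real l)\<close> with
  \<open>c > 0\<close>. Below, \<open>F\<close> is minus a logarithm, so that off the exceptional
  set a product over the coordinates is bounded from below.\<close>

lemma (in prob_space) weak_law_upper_tail:
  fixes F :: "'a \<Rightarrow> real"
  assumes F[measurable]: "F \<in> borel_measurable M"
    and bnd: "AE x in M. F x \<in> {lo..hi}" and "lo < hi" and "0 < e"
  shows "(\<lambda>l. measure (PiM {..<l} (\<lambda>_. M))
            {x \<in> space (PiM {..<l} (\<lambda>_. M)). real l * (expectation F + e) \<le> (\<Sum>i<l. F (x i))})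
         \<longlonglongrightarrow> 0" (is "?p \<longlonglongrightarrow> 0")
proof (rule tendsto_sandwich[OF _ _ tendsto_const])
  define c where "c = 2 * e\<^sup>2 / (hi - lo)\<^sup>2"
  have "c > 0" using assms by (simp add: c_def)
  show "(\<lambda>l. exp (- c * real l)) \<longlonglongrightarrow> 0"
    using LIMSEQ_realpow_zero[of "exp (- c)"] \<open>c > 0\<close>
    by (simp add: exp_of_nat_mult[symmetric] mult.commute)
  show "\<forall>\<^sub>F l in sequentially. 0 \<le> ?p l" by simp
  show "\<forall>\<^sub>F l in sequentially. ?p l \<le> exp (- c * real l)"
  proof (rule eventually_sequentiallyI)
    \<comment> \<open>Coordinate 0 is the reference variable of the identically distributed family,
      so at least one coordinate must exist.\<close>
    fix l :: nat assume l: "1 \<le> l"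
    then have ne: "{..<l} \<noteq> {}" using lessThan_empty_iff by auto
    let ?P = "PiM {..<l} (\<lambda>_. M)"
    interpret P: prob_space ?P
      by (intro prob_space_PiM prob_space_axioms)
    have comp: "distr ?P M (\<lambda>x. x i) = M" if "i < l" for i
      using that by (intro distr_PiM_component prob_space_axioms) auto
    have dF: "distr ?P borel (\<lambda>x. F (x i)) = distr M borel F" if "i < l" for i
    proof -
      have "distr ?P borel (\<lambda>x. F (x i)) = distr (distr ?P M (\<lambda>x. x i)) borel F"
        using that by (subst distr_distr) (auto simp: o_def)
      then show ?thesis using comp that by simp
    qed
    have 0: "0 < l" using l by simp
    interpret H: Hoeffding_ineq_iid ?P "{..<l}" "\<lambda>i x. F (x i)" "\<lambda>x. F (x 0)" lo hi
      "P.expectation (\<lambda>x. F (x 0))"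
    proof unfold_locales
      show "P.indep_vars (\<lambda>_. borel) (\<lambda>i x. F (x i)) {..<l}"
        using P.indep_vars_compose2[OF indep_vars_PiM_coordinates[OF _ ne], of "\<lambda>_. F" "\<lambda>_. borel"]
        by simp
      show "AE x in ?P. F (x 0) \<in> {lo..hi}"
        using 0 by (intro AE_PiM_component[where M = "\<lambda>_. M"] bnd prob_space_axioms) auto
      show "(\<lambda>x. F (x 0)) \<in> borel_measurable ?P"
        using 0 by (intro measurable_compose[where N = M, OF _ F] measurable_component_singleton) auto
    qed (use dF 0 in auto)
    have E: "P.expectation (\<lambda>x. F (x 0)) = expectation F"
    proof -
      have "expectation F = integral\<^sup>L (distr ?P M (\<lambda>x. x 0)) F" using comp[OF 0] by simp
      also have "\<dots> = P.expectation (\<lambda>x. F (x 0))"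
        using 0 by (intro integral_distr) auto
      finally show ?thesis by simp
    qed
    have "?p l \<le> exp (-2 * (real l * e)\<^sup>2 / (real l * (hi - lo)\<^sup>2))"
      using H.Hoeffding_ineq_ge[of "real l * e"] assms ne E by (simp add: algebra_simps)
    also have "-2 * (real l * e)\<^sup>2 / (real l * (hi - lo)\<^sup>2) = - c * real l"
      using 0 by (simp add: c_def power_mult_distrib power2_eq_square[of "real l"])
    finally show "?p l \<le> exp (- c * real l)" .
  qed
qed

section \<open>Greedy covering by boxes and the opposite counting bound\<close>

text \<open>First moment method: draw each \<open>s i\<close> independently with law
  \<open>q\<close>. A point \<open>x\<close> of \<open>R\<close> lies in the random box with
  probability at least \<open>c\<close>, so the expected measure of \<open>R\<close> inside the box
  is at least \<open>c\<close> times that of \<open>R\<close>, and some \<open>s\<close> does at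
  least as well as the average.\<close>

lemma (in prob_space) exists_box_meeting:
  fixes J :: "nat \<Rightarrow> 'a set" and q :: "nat \<Rightarrow> real"
  defines "P \<equiv> \<lambda>l. PiM {..<l::nat} (\<lambda>_. M)"
  assumes J: "\<And>k. k < n \<Longrightarrow> J k \<in> sets M" and q: "\<And>k. k < n \<Longrightarrow> 0 \<le> q k" "(\<Sum>k<n. q k) = 1"
    and R: "R \<in> sets (P l)"
    and c: "\<And>x. x \<in> R \<Longrightarrow> c \<le> (\<Prod>i<l. \<Sum>k<n. q k * indicator (J k) (x i))"
  shows "\<exists>s \<in> {..<l} \<rightarrow>\<^sub>E {..<n}. c * measure (P l) R \<le> measure (P l) (R \<inter> (\<Pi>\<^sub>E i\<in>{..<l}. J (s i)))"
proof (rule ccontr)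
  assume neg: "\<not> ?thesis"
  interpret P: prob_space "P l" unfolding P_def by (intro prob_space_PiM prob_space_axioms)
  let ?S = "{..<l} \<rightarrow>\<^sub>E {..<n}"
  let ?B = "\<lambda>s. \<Pi>\<^sub>E i\<in>{..<l}. J (s i)"
  \<comment> \<open>\<open>w s\<close> is the probability of drawing \<open>s\<close>.\<close>
  define w where "w = (\<lambda>s. \<Prod>i<l. q (s i))"
  have fin: "finite ?S" by (intro finite_PiE) auto
  have w0: "0 \<le> w s" if "s \<in> ?S" for s
    using that q by (auto simp: w_def PiE_iff intro!: prod_nonneg)
  have w1: "(\<Sum>s\<in>?S. w s) = 1"
    unfolding w_def by (subst prod_sum_PiE[symmetric]) (auto simp: q)
  have B: "?B s \<in> sets (P l)" if "s \<in> ?S" for s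
    unfolding P_def using that J by (intro sets_PiM_I_finite) (auto simp: PiE_iff)
  have RB: "R \<inter> ?B s \<in> sets (P l)" if "s \<in> ?S" for s
    using R B that by auto
  have "(\<Sum>s\<in>?S. w s * P.prob (R \<inter> ?B s)) = P.expectation (\<lambda>x. \<Sum>s\<in>?S. w s * indicator (R \<inter> ?B s) x)"
    using RB by (subst Bochner_Integration.integral_sum) (auto simp: P.emeasure_eq_measure)
  also have "\<dots> \<ge> P.expectation (\<lambda>x. c * indicator R x)"
  proof (intro integral_mono Bochner_Integration.integrable_sum)
    fix x assume "x \<in> space (P l)"
    \<comment> \<open>Points of \<open>R\<close> are extensional, so the indicator of a box is a
      product over the coordinates. \<open>prod_sum_PiE\<close> then turns the weighted sum over all
      \<open>s\<close> into the product of the sums over \<open>k\<close>.\<close>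
    have "indicator (?B s) x = (\<Prod>i<l. indicator (J (s i)) (x i) :: real)" if "x \<in> R" for s
    proof -
      have "x \<in> extensional {..<l}"
        using that sets.sets_into_space[OF R] by (auto simp: P_def space_PiM PiE_def)
      then show ?thesis
        by (auto simp: indicator_def PiE_iff prod_eq_1_iff)
    qed
    then have "(\<Sum>s\<in>?S. w s * indicator (R \<inter> ?B s) x)
        = indicator R x * (\<Prod>i<l. \<Sum>k<n. q k * indicator (J k) (x i))"
      by (subst prod_sum_PiE)
         (auto simp: w_def prod.distrib indicator_inter_arith indicator_def[of R] split: if_splits)
    then show "c * indicator R x \<le> (\<Sum>s\<in>?S. w s * indicator (R \<inter> ?B s) x)"
      using c by (auto simp: indicator_def[of R])
  qed (use RB R in \<open>auto simp: P.emeasure_eq_measure\<close>)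
  finally have le: "c * P.prob R \<le> (\<Sum>s\<in>?S. w s * P.prob (R \<inter> ?B s))"
    using R by simp
  \<comment> \<open>The negated claim is strict for every \<open>s\<close>; one index of positive
    weight keeps the weighted sum strict.\<close>
  obtain s0 where s0: "s0 \<in> ?S" "w s0 > 0"
  proof (rule ccontr)
    assume "\<not> thesis"
    then have "(\<Sum>s\<in>?S. w s) \<le> 0" using that by (intro sum_nonpos) force
    then show False using w1 by simp
  qed
  have "(\<Sum>s\<in>?S. w s * P.prob (R \<inter> ?B s)) < (\<Sum>s\<in>?S. w s * (c * P.prob R))"
    using neg s0 w0 fin
    by (intro sum_strict_mono_ex1)
       (auto simp: not_le intro!: bexI[of _ s0] mult_left_mono simp: less_imp_le)
  also have "\<dots> = c * P.prob R" by (simp only: sum_distrib_right[symmetric] w1)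
  finally show False using le by simp
qed

lemma sets_box:
  assumes "I \<subseteq> sets M" "B \<in> boxes l I"
  shows "B \<in> sets (PiM {..<l} (\<lambda>_. M))"
  using assms by (auto simp: boxes_def intro!: sets_PiM_I_finite)

text \<open>Greedy choice: applied to the part of \<open>R\<close> still uncovered,
  \<open>exists_box_meeting\<close> gives a box that removes at least the fraction \<open>c\<close>
  of it, so each round multiplies the remainder by at most \<open>1 - c\<close>.\<close>

lemma (in prob_space) exists_boxes_covering:
  fixes J :: "nat \<Rightarrow> 'a set" and q :: "nat \<Rightarrow> real"
  defines "P \<equiv> \<lambda>l. PiM {..<l::nat} (\<lambda>_. M)"
  assumes I: "I \<subseteq> sets M"
    and J: "\<And>k. k < n \<Longrightarrow> J k \<in> I" and q: "\<And>k. k < n \<Longrightarrow> 0 \<le> q k" "(\<Sum>k<n. q k) = 1"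
    and R: "R \<in> sets (P l)"
    and c: "\<And>x. x \<in> R \<Longrightarrow> c \<le> (\<Prod>i<l. \<Sum>k<n. q k * indicator (J k) (x i))" "c \<le> 1"
  shows "\<exists>B. finite B \<and> B \<subseteq> boxes l I \<and> card B \<le> N \<and> measure (P l) (R - \<Union>B) \<le> (1 - c) ^ N"
proof (induction N)
  case 0
  interpret P: prob_space "P l" unfolding P_def by (intro prob_space_PiM prob_space_axioms)
  show ?case by (auto intro!: exI[of _ "{}"])
next
  case (Suc N)
  interpret P: prob_space "P l" unfolding P_def by (intro prob_space_PiM prob_space_axioms)
  from Suc obtain B where B: "finite B" "B \<subseteq> boxes l I" "card B \<le> N" "P.prob (R - \<Union>B) \<le> (1 - c) ^ N"
    by blast
  have "\<Union>B \<in> sets (P l)"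
    using B sets_box[OF I] unfolding P_def by (intro sets.finite_Union) auto
  then have R': "R - \<Union>B \<in> sets (P l)" using R by auto
  obtain s where s: "s \<in> {..<l} \<rightarrow>\<^sub>E {..<n}"
    "c * P.prob (R - \<Union>B) \<le> P.prob ((R - \<Union>B) \<inter> (\<Pi>\<^sub>E i\<in>{..<l}. J (s i)))"
  proof -
    have "\<exists>s\<in>{..<l} \<rightarrow>\<^sub>E {..<n}. c * P.prob (R - \<Union>B)
        \<le> P.prob ((R - \<Union>B) \<inter> (\<Pi>\<^sub>E i\<in>{..<l}. J (s i)))"
      unfolding P_def
    proof (rule exists_box_meeting[where q = q])
      show "J k \<in> sets M" if "k < n" for k using J[OF that] I by blast
      show "c \<le> (\<Prod>i<l. \<Sum>k<n. q k * indicator (J k) (x i))" if "x \<in> R - \<Union>B" for x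
        using c(1) that by blast
    qed (use q R' in \<open>simp_all add: P_def\<close>)
    then show ?thesis using that by blast
  qed
  define b where "b = (\<Pi>\<^sub>E i\<in>{..<l}. J (s i))"
  have b: "b \<in> boxes l I" unfolding b_def boxes_def
    using PiE_mem[OF s(1)] J by (intro CollectI exI[of _ "\<lambda>i. J (s i)"]) auto
  have bs: "b \<in> sets (P l)" using sets_box[OF I b] by (simp add: P_def)
  have "P.prob (R - \<Union>(insert b B)) = P.prob ((R - \<Union>B) - ((R - \<Union>B) \<inter> b))"
    by (rule arg_cong[where f = P.prob]) auto
  also have "\<dots> = P.prob (R - \<Union>B) - P.prob ((R - \<Union>B) \<inter> b)"
    using R' bs by (intro P.finite_measure_Diff) auto
  also have "\<dots> \<le> (1 - c) * P.prob (R - \<Union>B)"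
    using s by (simp add: algebra_simps b_def)
  also have "\<dots> \<le> (1 - c) * (1 - c) ^ N"
    using B c by (intro mult_left_mono) auto
  finally show ?case
    using B b by (intro exI[of _ "insert b B"]) (auto simp: card_insert_if)
qed

text \<open>By Tonelli, the product of the \<open>g (x i)\<close> has integral at most 1 over each
  box. As it is at least \<open>K\<close> on \<open>T\<close>, Markov's inequality gives that one
  box meets \<open>T\<close> in measure at most \<open>1 / K\<close> when \<open>K > 0\<close>;
  summing over \<open>B\<close> gives the bound.\<close>

lemma (in prob_space) boxes_needed:
  fixes g :: "'a \<Rightarrow> real"
  defines "P \<equiv> \<lambda>l. PiM {..<l::nat} (\<lambda>_. M)"
  assumes I: "I \<subseteq> sets M" and B: "finite B" "B \<subseteq> boxes l I"
    and g[measurable]: "g \<in> borel_measurable M" "\<And>x. 0 \<le> g x"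
    and gI: "\<And>J. J \<in> I \<Longrightarrow> (\<integral>\<^sup>+x. ennreal (g x * indicator J x) \<partial>M) \<le> 1"
    and T: "T \<in> sets (P l)" "\<And>x. x \<in> T \<Longrightarrow> K \<le> (\<Prod>i<l. g (x i))" and "0 \<le> K"
  shows "K * measure (P l) (T \<inter> \<Union>B) \<le> card B"
proof -
  interpret P: prob_space "P l" unfolding P_def by (intro prob_space_PiM prob_space_axioms)
  interpret Q: product_sigma_finite "\<lambda>_::nat. M" by unfold_locales
  have Bs: "b \<in> sets (P l)" if "b \<in> B" for b
    using B sets_box[OF I] that unfolding P_def by auto
  have one: "ennreal K * emeasure (P l) (T \<inter> b) \<le> 1" if b: "b \<in> B" for b
  proof -
    obtain J where J: "b = Pi\<^sub>E {..<l} J" "\<And>i. i < l \<Longrightarrow> J i \<in> I"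
      using B b by (auto simp: boxes_def)
    have Jm[measurable]: "\<And>i. i < l \<Longrightarrow> J i \<in> sets M" using J I by auto
    have "ennreal K * emeasure (P l) (T \<inter> b) = (\<integral>\<^sup>+x. ennreal K * indicator (T \<inter> b) x \<partial>P l)"
      using T Bs[OF b] by (intro nn_integral_cmult_indicator[symmetric]) auto
    also have "\<dots> \<le> (\<integral>\<^sup>+x. (\<Prod>i<l. ennreal (g (x i) * indicator (J i) (x i))) \<partial>P l)"
    proof (intro nn_integral_mono)
      fix x
      show "ennreal K * indicator (T \<inter> b) x \<le> (\<Prod>i<l. ennreal (g (x i) * indicator (J i) (x i)))"
      proof (cases "x \<in> T \<inter> b")
        case True
        then have "(\<Prod>i<l. g (x i) * indicator (J i) (x i)) = (\<Prod>i<l. g (x i))"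
          using J by (intro prod.cong) (auto simp: PiE_iff)
        then show ?thesis using True T(2) by (subst prod_ennreal) (auto simp: g intro!: ennreal_leI)
      qed simp
    qed
    also have "\<dots> = (\<Prod>i<l. \<integral>\<^sup>+x. ennreal (g x * indicator (J i) x) \<partial>M)"
      unfolding P_def
      by (rule Q.product_nn_integral_prod[where f = "\<lambda>i y. ennreal (g y * indicator (J i) y)"]) auto
    also have "\<dots> \<le> 1"
      using gI J by (intro prod_le_1) auto
    finally show ?thesis .
  qed
  have "ennreal (K * P.prob (T \<inter> \<Union>B)) = ennreal K * emeasure (P l) (\<Union>b\<in>B. T \<inter> b)"
    using \<open>0 \<le> K\<close> by (simp add: ennreal_mult P.emeasure_eq_measure)
  also have "\<dots> \<le> ennreal K * (\<Sum>b\<in>B. emeasure (P l) (T \<inter> b))"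
    using B Bs T by (intro mult_left_mono emeasure_subadditive_finite) auto
  also have "\<dots> \<le> (\<Sum>b\<in>B. 1)"
    unfolding sum_distrib_left by (intro sum_mono one)
  finally have "ennreal (K * P.prob (T \<inter> \<Union>B)) \<le> ennreal (real (card B))"
    by (simp add: ennreal_of_nat_eq_real_of_nat)
  then show ?thesis by (subst (asm) ennreal_le_iff) auto
qed

section \<open>Log-integrals on the vertex packing polytope\<close>

text \<open>The quantity \<open>r\<close> is the squared ratio of the geometric to the arithmetic
  mean. Then \<open>- ln r \<ge> 1 - r\<close>, and \<open>1 - r\<close> is the square of
  \<open>(x - y) / (x + y)\<close>, where \<open>x + y \<le> 2\<close>.\<close>

lemma ln_midpoint_ge:
  fixes x y :: real
  assumes "0 < x" "x \<le> 1" "0 < y" "y \<le> 1"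
  shows "(ln x + ln y) / 2 + (x - y)\<^sup>2 / 8 \<le> ln ((x + y) / 2)"
proof -
  define r where "r = 4 * x * y / (x + y)\<^sup>2"
  have r: "r > 0" using assms by (simp add: r_def)
  have "(x + y)\<^sup>2 \<le> 2\<^sup>2" using assms by (intro power_mono) auto
  then have "(x - y)\<^sup>2 / 4 \<le> (x - y)\<^sup>2 / (x + y)\<^sup>2"
    using assms by (intro divide_left_mono) auto
  also have "\<dots> = 1 - r"
  proof -
    have "(x + y)\<^sup>2 \<noteq> 0" using assms by simp
    then show ?thesis by (simp add: r_def diff_divide_eq_iff divide_eq_eq eq_divide_eq)
      (simp add: power2_eq_square algebra_simps)
  qed
  also have "\<dots> \<le> - ln r"
    using ln_le_minus_one[OF r] by simp
  also have "ln r = ln x + ln y - 2 * ln ((x + y) / 2)"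
    using assms ln_realpow[of 2 2] by (simp add: r_def ln_mult ln_div ln_realpow)
  finally show ?thesis by argo
qed

section \<open>Convex combinations of indicators\<close>

lemma sum_lessThan_add:
  "(\<Sum>k<n + m. h k) = (\<Sum>k<n. h k) + (\<Sum>k<m. h (n + k :: nat))"
  for h :: "nat \<Rightarrow> 'b::comm_monoid_add"
  by (induction m) (auto simp: ac_simps)

lemma indicator_in_VP: "J \<in> I \<Longrightarrow> indicator J \<in> VP I"
  unfolding VP_def by (intro CollectI exI[of _ 1] exI[of _ "\<lambda>_. 1"] exI[of _ "\<lambda>_. J"]) auto

lemma VP_E:
  assumes "f \<in> VP I"
  obtains n :: nat and q J where "\<forall>k<n. J k \<in> I \<and> 0 \<le> q k" "(\<Sum>k<n. q k) = 1"
    "f = (\<lambda>x. \<Sum>k<n. q k * indicator (J k) x)"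
  using assms unfolding VP_def mem_Collect_eq by metis

lemma VP_bounds:
  assumes "f \<in> VP I"
  shows "0 \<le> f x" "f x \<le> 1"
proof -
  obtain n :: nat and q J where *: "\<forall>k<n. J k \<in> I \<and> 0 \<le> q k" "(\<Sum>k<n. q k) = 1"
    "f = (\<lambda>x. \<Sum>k<n. q k * indicator (J k) x)"
    by (rule VP_E[OF assms]) (rule that, assumption+)
  show "0 \<le> f x" using * by (auto intro!: sum_nonneg)
  have "f x \<le> (\<Sum>k<n. q k)"
    unfolding *(3) using *(1) by (intro sum_mono) (auto simp: indicator_def)
  then show "f x \<le> 1" using * by simp
qed

lemma VP_convex:
  assumes "f \<in> VP I" "g \<in> VP I" "0 \<le> t" "t \<le> 1"
  shows "(\<lambda>x. (1 - t) * f x + t * g x) \<in> VP I"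
proof -
  obtain n :: nat and q J where f: "\<forall>k<n. J k \<in> I \<and> 0 \<le> q k" "(\<Sum>k<n. q k) = 1"
    "f = (\<lambda>x. \<Sum>k<n. q k * indicator (J k) x)"
    by (rule VP_E[OF assms(1)]) (rule that, assumption+)
  obtain m :: nat and p K where g: "\<forall>k<m. K k \<in> I \<and> 0 \<le> p k" "(\<Sum>k<m. p k) = 1"
    "g = (\<lambda>x. \<Sum>k<m. p k * indicator (K k) x)"
    by (rule VP_E[OF assms(2)]) (rule that, assumption+)
  \<comment> \<open>The two weighted families are concatenated, the second one shifted by
    \<open>n\<close>.\<close>
  let ?w = "\<lambda>k. if k < n then (1 - t) * q k else t * p (k - n)"
  let ?L = "\<lambda>k. if k < n then J k else K (k - n)"
  have "(\<Sum>k<n + m. ?w k) = 1"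
    by (simp add: sum_lessThan_add sum_distrib_left[symmetric] f g)
  moreover have "(\<lambda>x. (1 - t) * f x + t * g x) = (\<lambda>x. \<Sum>k<n + m. ?w k * indicator (?L k) x)"
    by (simp add: sum_lessThan_add sum_distrib_left f(3) g(3) mult.assoc del: sum_mult_indicator)
  ultimately show ?thesis
    unfolding VP_def using assms f(1) g(1)
    by (intro CollectI exI[of _ "n + m"] exI[of _ ?w] exI[of _ ?L]) auto
qed

section \<open>Finiteness of \<open>phi\<close> as integrability of the logarithm\<close>

text \<open>Positivity is a separate condition because the real \<open>ln\<close> is total:
  integrability alone would not see a set of positive measure on which \<open>b\<close>
  vanishes.\<close>

definition log_integrable :: "'a measure \<Rightarrow> ('a \<Rightarrow> real) \<Rightarrow> bool" where
  "log_integrable M b \<longleftrightarrow> (AE x in M. 0 < b x) \<and> integrable M (\<lambda>x. ln (b x))"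

lemma e2ennreal_neg_ext_ln:
  "e2ennreal (- ext_ln (ereal y)) = (if y \<le> 0 then top else ennreal (- ln y))"
  by (auto simp: ext_ln_def e2ennreal_infty zero_ereal_def infinity_ennreal_def)

text \<open>Where \<open>b \<le> 1\<close> the extended logarithm is nonpositive, so the subtracted
  integral in \<open>phi\<close> vanishes.\<close>

lemma phi_eq_nn_integral:
  assumes "b \<in> borel_measurable M" "AE x in M. b x \<le> 1"
  shows "phi M b = enn2ereal (\<integral>\<^sup>+x. (if b x \<le> 0 then top else ennreal (- ln (b x))) \<partial>M)"
proof -
  have "(\<integral>\<^sup>+x. e2ennreal (ext_ln (ereal (b x))) \<partial>M) = (\<integral>\<^sup>+x. 0 \<partial>M)"
    using assms(2) by (intro nn_integral_cong_AE)
      (auto elim!: eventually_mono intro!: e2ennreal_neg simp: ext_ln_def ennreal_neg)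
  then show ?thesis by (simp add: phi_def e2ennreal_neg_ext_ln zero_ennreal.rep_eq)
qed

lemma phi_log_integrable:
  assumes "b \<in> borel_measurable M" "AE x in M. b x \<le> 1" "log_integrable M b"
  shows "phi M b = ereal (- (\<integral>x. ln (b x) \<partial>M))"
proof -
  have "(\<integral>\<^sup>+x. (if b x \<le> 0 then top else ennreal (- ln (b x))) \<partial>M) = (\<integral>\<^sup>+x. ennreal (- ln (b x)) \<partial>M)"
    using assms(3) by (intro nn_integral_cong_AE) (auto simp: log_integrable_def elim!: eventually_mono)
  also have "\<dots> = ennreal (\<integral>x. - ln (b x) \<partial>M)"
    using assms(2,3) by (intro nn_integral_eq_integral) (auto simp: log_integrable_def elim!: AE_mp)
  also have "\<dots> = ennreal (- (\<integral>x. ln (b x) \<partial>M))" by simp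
  finally have *: "phi M b = enn2ereal (ennreal (- (\<integral>x. ln (b x) \<partial>M)))"
    using phi_eq_nn_integral[OF assms(1,2)] by simp
  have "0 \<le> (\<integral>x. - ln (b x) \<partial>M)"
    using assms(2,3) by (intro integral_nonneg_AE) (auto simp: log_integrable_def elim!: AE_mp)
  then show ?thesis unfolding * by (simp add: enn2ereal_ennreal)
qed

lemma log_integrableI_nn_integral:
  assumes [measurable]: "b \<in> borel_measurable M" and "AE x in M. b x \<le> 1"
    and fin: "(\<integral>\<^sup>+x. (if b x \<le> 0 then top else ennreal (- ln (b x))) \<partial>M) < \<infinity>"
  shows "log_integrable M b"
proof -
  have "AE x in M. (if b x \<le> 0 then top else ennreal (- ln (b x))) \<noteq> \<infinity>"
    using fin by (intro nn_integral_PInf_AE) auto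
  then have pos: "AE x in M. 0 < b x" by eventually_elim (auto split: if_splits)
  have "(\<integral>\<^sup>+x. ennreal (- ln (b x)) \<partial>M) = (\<integral>\<^sup>+x. (if b x \<le> 0 then top else ennreal (- ln (b x))) \<partial>M)"
    using pos by (intro nn_integral_cong_AE) (auto elim!: eventually_mono)
  also note fin
  finally have "integrable M (\<lambda>x. - ln (b x))"
    using pos assms(2) by (intro integrableI_nonneg) (auto elim!: AE_mp)
  then show ?thesis using pos by (simp add: log_integrable_def)
qed

lemma phi_not_log_integrable:
  assumes "b \<in> borel_measurable M" "AE x in M. b x \<le> 1" "\<not> log_integrable M b"
  shows "phi M b = \<infinity>"
proof -
  have "(\<integral>\<^sup>+x. (if b x \<le> 0 then top else ennreal (- ln (b x))) \<partial>M) = \<infinity>"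
    using log_integrableI_nn_integral[OF assms(1,2)] assms(3) less_top by fastforce
  then show ?thesis using phi_eq_nn_integral[OF assms(1,2)] by simp
qed

text \<open>The function \<open>ln (f x)\<close> lies between \<open>ln c + ln (b x)\<close> and
  0.\<close>

lemma log_integrable_mono:
  assumes [measurable]: "f \<in> borel_measurable M" and "log_integrable M b" "0 < c"
    and bnd: "AE x in M. c * b x \<le> f x" "AE x in M. f x \<le> 1"
    and fin: "finite_measure M"
  shows "log_integrable M f"
proof -
  interpret finite_measure M by fact
  have b: "AE x in M. 0 < b x" "integrable M (\<lambda>x. ln (b x))"
    using assms by (auto simp: log_integrable_def)
  have pos: "AE x in M. 0 < f x"
    using b(1) bnd(1) 
  proof eventually_elim
    case (elim x)
    then have "0 < c * b x" using \<open>0 < c\<close> by simp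
    then show ?case using elim by simp
  qed
  have "integrable M (\<lambda>x. ln (f x))"
  proof (rule Bochner_Integration.integrable_bound)
    show "integrable M (\<lambda>x. \<bar>ln c\<bar> + \<bar>ln (b x)\<bar>)" using b by simp
    show "AE x in M. norm (ln (f x)) \<le> norm (\<bar>ln c\<bar> + \<bar>ln (b x)\<bar>)"
      using pos b(1) bnd
    proof eventually_elim
      case (elim x)
      then have "ln (c * b x) \<le> ln (f x)" using \<open>0 < c\<close> by (subst ln_le_cancel_iff) auto
      moreover have "ln (f x) \<le> 0" using elim by simp
      ultimately show ?case using elim \<open>0 < c\<close> by (simp add: ln_mult)
    qed
  qed simp
  then show ?thesis using pos by (simp add: log_integrable_def)
qed

section \<open>The closure of \<open>VP I\<close> in \<open>L1\<close>\<close>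

locale set_system = prob_space M for M :: "'a measure" +
  fixes I :: "'a set set"
  assumes I: "I \<subseteq> sets M"
begin

lemma VP_measurable: "f \<in> VP I \<Longrightarrow> f \<in> borel_measurable M"
  unfolding VP_def using I
  by (auto simp del: sum_mult_indicator intro!: borel_measurable_sum borel_measurable_times borel_measurable_indicator)

lemma VP_integrable: "f \<in> VP I \<Longrightarrow> integrable M f"
  by (rule integrable_const_bound[of _ 1]) (auto simp: VP_bounds VP_measurable)

lemma VP_subset_closure: "VP I \<subseteq> VP_closure M I"
  using VP_integrable by (auto simp: VP_closure_def intro!: bexI)

lemma closure_measurable: "b \<in> VP_closure M I \<Longrightarrow> b \<in> borel_measurable M"
  and closure_integrable: "b \<in> VP_closure M I \<Longrightarrow> integrable M b"
  by (auto simp: VP_closure_def)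

lemma closure_approx:
  assumes "b \<in> VP_closure M I" "0 < e"
  obtains f where "f \<in> VP I" "(\<integral>x. \<bar>b x - f x\<bar> \<partial>M) < e"
  using assms by (auto simp: VP_closure_def)

lemma closure_convex:
  assumes "a \<in> VP_closure M I" "b \<in> VP_closure M I" "0 \<le> t" "t \<le> 1"
  shows "(\<lambda>x. (1 - t) * a x + t * b x) \<in> VP_closure M I"
  unfolding VP_closure_def
proof (safe)
  note [simp] = closure_integrable[OF assms(1)] closure_integrable[OF assms(2)]
  show "integrable M (\<lambda>x. (1 - t) * a x + t * b x)" by simp
  fix e :: real assume "0 < e"
  obtain f where f: "f \<in> VP I" "(\<integral>x. \<bar>a x - f x\<bar> \<partial>M) < e / 2"
    using closure_approx[OF assms(1), of "e / 2"] \<open>0 < e\<close> by auto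
  obtain g where g: "g \<in> VP I" "(\<integral>x. \<bar>b x - g x\<bar> \<partial>M) < e / 2"
    using closure_approx[OF assms(2), of "e / 2"] \<open>0 < e\<close> by auto
  note [simp] = VP_integrable[OF f(1)] VP_integrable[OF g(1)]
  let ?h = "\<lambda>x. (1 - t) * f x + t * g x"
  have "(\<integral>x. \<bar>(1 - t) * a x + t * b x - ?h x\<bar> \<partial>M) \<le> (\<integral>x. \<bar>a x - f x\<bar> + \<bar>b x - g x\<bar> \<partial>M)"
  proof (intro integral_mono)
    fix x
    have "\<bar>(1 - t) * a x + t * b x - ?h x\<bar> = \<bar>(1 - t) * (a x - f x) + t * (b x - g x)\<bar>"
      by (simp add: algebra_simps)
    also have "\<dots> \<le> (1 - t) * \<bar>a x - f x\<bar> + t * \<bar>b x - g x\<bar>"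
      using assms by (intro order_trans[OF abs_triangle_ineq]) (simp add: abs_mult)
    also have "\<dots> \<le> 1 * \<bar>a x - f x\<bar> + 1 * \<bar>b x - g x\<bar>"
      using assms by (intro add_mono mult_right_mono) auto
    finally show "\<bar>(1 - t) * a x + t * b x - ?h x\<bar> \<le> \<bar>a x - f x\<bar> + \<bar>b x - g x\<bar>" by simp
  qed auto
  also have "\<dots> < e" using f g by simp
  finally show "\<exists>h\<in>VP I. (\<integral>x. \<bar>(1 - t) * a x + t * b x - h x\<bar> \<partial>M) < e"
    by (rule bexI[OF _ VP_convex[OF f(1) g(1) assms(3,4)]])
qed

text \<open>Truncating \<open>b\<close> to the unit interval changes it by no more than its distance
  to any function with values there. Members of \<open>VP I\<close> are such functions and come
  arbitrarily close in \<open>L1\<close>, so the truncation changes \<open>b\<close> only on a null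
  set.\<close>

lemma closure_bounds:
  assumes "b \<in> VP_closure M I"
  shows "AE x in M. 0 \<le> b x \<and> b x \<le> 1"
proof -
  note [simp] = closure_integrable[OF assms]
  note [measurable] = closure_measurable[OF assms]
  let ?d = "\<lambda>x. \<bar>b x - max 0 (min 1 (b x))\<bar>"
  have int: "integrable M ?d"
    by (rule Bochner_Integration.integrable_bound[of _ b]) (auto simp: abs_if)
  have "(\<integral>x. ?d x \<partial>M) \<le> 0 + e" if "0 < e" for e
  proof -
    obtain f where f: "f \<in> VP I" "(\<integral>x. \<bar>b x - f x\<bar> \<partial>M) < e"
      using closure_approx[OF assms \<open>0 < e\<close>] by blast
    have "(\<integral>x. ?d x \<partial>M) \<le> (\<integral>x. \<bar>b x - f x\<bar> \<partial>M)"
    proof (intro integral_mono int)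
      fix x show "?d x \<le> \<bar>b x - f x\<bar>"
        using VP_bounds[OF f(1), of x] by (auto simp: abs_if min_def max_def)
    qed (use VP_integrable[OF f(1)] in auto)
    then show ?thesis using f by simp
  qed
  then have "(\<integral>x. ?d x \<partial>M) \<le> 0" by (rule field_le_epsilon)
  moreover have "0 \<le> (\<integral>x. ?d x \<partial>M)" by simp
  ultimately have "(\<integral>x. ?d x \<partial>M) = 0" by simp
  then have "AE x in M. ?d x = 0"
    using integral_nonneg_eq_0_iff_AE[OF int] by simp
  then show ?thesis by eventually_elim auto
qed

lemma log_integrable_ge_const:
  assumes "f \<in> borel_measurable M" "0 < d" "AE x in M. d \<le> f x" "AE x in M. f x \<le> 1"
  shows "log_integrable M f"
  by (rule log_integrable_mono[of _ _ "\<lambda>_. 1" d])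
     (use assms finite_measure_axioms in \<open>auto simp: log_integrable_def\<close>)

end

section \<open>Existence and uniqueness of the maximiser of the log-integral\<close>

text \<open>The finite cover number enters through \<open>u\<close>: mixing it in bounds functions
  away from 0, where \<open>ln\<close> is Lipschitz.\<close>

locale covered_system = set_system +
  fixes u :: "'a \<Rightarrow> real" and \<delta> :: real
  assumes u: "u \<in> VP I" and \<delta>: "0 < \<delta>" and u_ge: "AE x in M. \<delta> \<le> u x"
begin

text \<open>This is minus the infimum of \<open>phi\<close> over \<open>VP I\<close>. The
  restriction to log-integrable functions matters: a nonintegrable logarithm has Bochner integral 0
  by convention, which is the largest value possible here.\<close>

definition max_log :: real where
  "max_log = Sup {\<integral>x. ln (f x) \<partial>M | f. f \<in> VP I \<and> log_integrable M f}"

lemma u_log_integrable: "log_integrable M u"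
  using log_integrable_ge_const[OF VP_measurable[OF u] \<delta> u_ge] VP_bounds[OF u] by simp

lemma log_integral_nonpos:
  assumes "f \<in> VP I" "log_integrable M f"
  shows "(\<integral>x. ln (f x) \<partial>M) \<le> 0"
proof -
  have "0 \<le> (\<integral>x. - ln (f x) \<partial>M)"
    using assms VP_bounds[OF assms(1)]
    by (intro integral_nonneg_AE) (auto simp: log_integrable_def elim!: eventually_mono)
  then show ?thesis by simp
qed

lemma bdd_above_log_integrals: "bdd_above {\<integral>x. ln (f x) \<partial>M | f. f \<in> VP I \<and> log_integrable M f}"
  by (rule bdd_aboveI[of _ 0]) (auto intro: log_integral_nonpos)

lemma max_log_nonpos: "max_log \<le> 0"
  unfolding max_log_def using u u_log_integrable by (intro cSup_least) (auto intro: log_integral_nonpos)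

lemma VP_log_integral_le: "f \<in> VP I \<Longrightarrow> log_integrable M f \<Longrightarrow> (\<integral>x. ln (f x) \<partial>M) \<le> max_log"
  unfolding max_log_def by (rule cSup_upper[OF _ bdd_above_log_integrals]) auto

lemma VP_log_integral_approx:
  assumes "0 < e"
  shows "\<exists>f\<in>VP I. log_integrable M f \<and> max_log - e < (\<integral>x. ln (f x) \<partial>M)"
proof -
  have "\<exists>y\<in>{\<integral>x. ln (f x) \<partial>M | f. f \<in> VP I \<and> log_integrable M f}. max_log - e < y"
    unfolding max_log_def using assms u u_log_integrable bdd_above_log_integrals
    by (subst less_cSup_iff[symmetric]) auto
  then show ?thesis by auto
qed

text \<open>Mixing in a small multiple of \<open>u\<close> keeps the approximants away from \<open>0\<close> and costs
  little, since \<open>ln ((1 - t) b + t u) \<ge> ln (1 - t) + ln b\<close>.\<close>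

lemma VP_bounded_approx:
  assumes b: "b \<in> VP_closure M I" "log_integrable M b" and "0 < e"
  shows "\<exists>f\<in>VP I. \<exists>d>0. (AE x in M. d \<le> f x) \<and> (\<integral>x. ln (b x) \<partial>M) - e \<le> (\<integral>x. ln (f x) \<partial>M)"
proof -
  \<comment> \<open>Chosen so that the loss \<open>ln (1 - t)\<close> from mixing is exactly half of
    the allowed error.\<close>
  define t where "t = 1 - exp (- e / 2)"
  have t: "0 < t" "t < 1" "ln (1 - t) = - e / 2" using \<open>0 < e\<close> by (auto simp: t_def)
  define d where "d = t * \<delta>"
  have d: "0 < d" using t \<delta> by (simp add: d_def)
  \<comment> \<open>The logarithm has slope at most \<open>1 / d\<close> above \<open>d\<close>, so
    this tolerance costs at most the other half \<open>e / 2\<close>.\<close>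
  obtain f0 where f0: "f0 \<in> VP I" "(\<integral>x. \<bar>b x - f0 x\<bar> \<partial>M) < d * e / 2"
    using closure_approx[OF b(1), of "d * e / 2"] d \<open>0 < e\<close> by auto
  define f where "f = (\<lambda>x. (1 - t) * f0 x + t * u x)"
  have f: "f \<in> VP I" unfolding f_def using t by (intro VP_convex f0 u) auto
  have f_ge: "AE x in M. d \<le> f x"
    using u_ge
  proof eventually_elim
    case (elim x)
    have "0 \<le> (1 - t) * f0 x" using t VP_bounds(1)[OF f0(1), of x] by simp
    moreover have "t * \<delta> \<le> t * u x" using t elim by simp
    ultimately show ?case by (simp add: f_def d_def)
  qed
  have lf: "log_integrable M f"
    using log_integrable_ge_const[OF VP_measurable[OF f] d f_ge] VP_bounds[OF f] by simp
  have b': "AE x in M. 0 < b x" "integrable M (\<lambda>x. ln (b x))" using b by (auto simp: log_integrable_def)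
  have int: "integrable M (\<lambda>x. \<bar>b x - f0 x\<bar>)"
    using closure_integrable[OF b(1)] VP_integrable[OF f0(1)] by simp
  have "(\<integral>x. ln (b x) + ln (1 - t) - \<bar>b x - f0 x\<bar> / d \<partial>M) \<le> (\<integral>x. ln (f x) \<partial>M)"
  proof (intro integral_mono_AE)
    show "AE x in M. ln (b x) + ln (1 - t) - \<bar>b x - f0 x\<bar> / d \<le> ln (f x)"
      using b'(1) f_ge u_ge
    proof eventually_elim
      case (elim x)
      \<comment> \<open>\<open>c\<close> is the mixture with \<open>b\<close> in place of its
        approximant \<open>f0\<close>: passing from \<open>b\<close> to \<open>c\<close> loses at
        most \<open>- ln (1 - t)\<close>, passing from \<open>c\<close> to \<open>f\<close> at most
        the scaled distance of \<open>b\<close> and \<open>f0\<close>.\<close>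
      define c where "c = (1 - t) * b x + t * u x"
      have "0 < (1 - t) * b x" using t elim by simp
      moreover have "0 \<le> t * u x" using t elim \<delta> by simp
      ultimately have c: "0 < c" "ln ((1 - t) * b x) \<le> ln c"
        by (auto simp: c_def)
      have fx: "0 < f x" using elim d by simp
      have "ln (b x) + ln (1 - t) \<le> ln c"
        using c(2) elim t by (simp add: ln_mult)
      moreover have "ln c - ln (f x) \<le> \<bar>b x - f0 x\<bar> / d"
      proof -
        have "ln c - ln (f x) \<le> c / f x - 1"
          using ln_le_minus_one[of "c / f x"] c fx by (simp add: ln_div)
        also have "\<dots> = (1 - t) * (b x - f0 x) / f x"
          using fx by (simp add: f_def c_def field_simps)
        also have "\<dots> \<le> \<bar>b x - f0 x\<bar> / f x"
        proof (intro divide_right_mono)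
          have "(1 - t) * (b x - f0 x) \<le> (1 - t) * \<bar>b x - f0 x\<bar>"
            using t by (intro mult_left_mono) auto
          also have "\<dots> \<le> 1 * \<bar>b x - f0 x\<bar>"
            using t by (intro mult_right_mono) auto
          finally show "(1 - t) * (b x - f0 x) \<le> \<bar>b x - f0 x\<bar>" by simp
        qed (use fx in auto)
        also have "\<dots> \<le> \<bar>b x - f0 x\<bar> / d"
          using elim d by (intro divide_left_mono) auto
        finally show ?thesis .
      qed
      ultimately show ?case by linarith
    qed
  qed (use lf b' int in \<open>auto simp: log_integrable_def\<close>)
  also have "(\<integral>x. ln (b x) + ln (1 - t) - \<bar>b x - f0 x\<bar> / d \<partial>M)
      = (\<integral>x. ln (b x) \<partial>M) - e / 2 - (\<integral>x. \<bar>b x - f0 x\<bar> \<partial>M) / d"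
    using b' int t by (simp add: prob_space)
  finally have "(\<integral>x. ln (b x) \<partial>M) - e / 2 - (\<integral>x. \<bar>b x - f0 x\<bar> \<partial>M) / d \<le> (\<integral>x. ln (f x) \<partial>M)" .
  moreover have "(\<integral>x. \<bar>b x - f0 x\<bar> \<partial>M) / d < e / 2"
    using f0(2) d by (simp add: pos_divide_less_eq algebra_simps)
  ultimately have "(\<integral>x. ln (b x) \<partial>M) - e \<le> (\<integral>x. ln (f x) \<partial>M)" by linarith
  then show ?thesis using f f_ge d by blast
qed

lemma closure_log_integral_le:
  assumes "b \<in> VP_closure M I" "log_integrable M b"
  shows "(\<integral>x. ln (b x) \<partial>M) \<le> max_log"
proof (rule field_le_epsilon)
  fix e :: real assume "0 < e"
  obtain f d where f: "f \<in> VP I" "0 < d" "AE x in M. d \<le> f x"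
    "(\<integral>x. ln (b x) \<partial>M) - e \<le> (\<integral>x. ln (f x) \<partial>M)"
    using VP_bounded_approx[OF assms \<open>0 < e\<close>] by blast
  have "log_integrable M f"
    using log_integrable_ge_const[OF VP_measurable[OF f(1)] f(2,3)] VP_bounds[OF f(1)] by simp
  then show "(\<integral>x. ln (b x) \<partial>M) \<le> max_log + e"
    using VP_log_integral_le[OF f(1)] f(4) by simp
qed

lemma integrable_square_diff:
  assumes f: "f \<in> VP_closure M I" and g: "g \<in> VP_closure M I"
  shows "integrable M (\<lambda>x. (f x - g x)\<^sup>2)"
proof (rule integrable_const_bound[of _ 1])
  show "AE x in M. norm ((f x - g x)\<^sup>2) \<le> 1"
    using closure_bounds[OF f] closure_bounds[OF g]
    by eventually_elim (auto simp: abs_square_le_1 power2_le_iff_abs_le abs_le_iff)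
qed (use closure_measurable f g in simp)

text \<open>Integrate \<open>ln_midpoint_ge\<close>: the midpoint \<open>h\<close> is again in the
  closure, so its log-integral is at most \<open>max_log\<close>. Near-maximisers are therefore
  close to each other in \<open>L2\<close>.\<close>

lemma integral_square_diff_le:
  assumes f: "f \<in> VP_closure M I" "log_integrable M f" and g: "g \<in> VP_closure M I" "log_integrable M g"
  shows "(\<integral>x. (f x - g x)\<^sup>2 \<partial>M) \<le> 8 * (max_log - ((\<integral>x. ln (f x) \<partial>M) + (\<integral>x. ln (g x) \<partial>M)) / 2)"
proof -
  define h where "h = (\<lambda>x. (f x + g x) / 2)"
  have h: "h \<in> VP_closure M I"
    using closure_convex[OF f(1) g(1), of "1 / 2"] by (simp add: h_def add_divide_distrib)
  have pos: "AE x in M. 0 < f x" "AE x in M. 0 < g x"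
    and int: "integrable M (\<lambda>x. ln (f x))" "integrable M (\<lambda>x. ln (g x))"
    using f g by (auto simp: log_integrable_def)
  note bnd = closure_bounds[OF f(1)] closure_bounds[OF g(1)]
  have lh: "log_integrable M h"
  proof (rule log_integrable_mono[of _ _ f "1 / 2"])
    show "AE x in M. 1 / 2 * f x \<le> h x"
      using bnd by eventually_elim (auto simp: h_def)
    show "AE x in M. h x \<le> 1"
      using bnd by eventually_elim (auto simp: h_def)
  qed (use closure_measurable[OF h] f finite_measure_axioms in auto)
  have "(\<integral>x. (ln (f x) + ln (g x)) / 2 + (f x - g x)\<^sup>2 / 8 \<partial>M) \<le> (\<integral>x. ln (h x) \<partial>M)"
  proof (intro integral_mono_AE)
    show "AE x in M. (ln (f x) + ln (g x)) / 2 + (f x - g x)\<^sup>2 / 8 \<le> ln (h x)"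
      using pos bnd by eventually_elim (auto simp: h_def intro!: ln_midpoint_ge)
  qed (use int lh integrable_square_diff[OF f(1) g(1)] in \<open>auto simp: log_integrable_def\<close>)
  also have "\<dots> \<le> max_log" by (rule closure_log_integral_le[OF h lh])
  finally have "((\<integral>x. ln (f x) \<partial>M) + (\<integral>x. ln (g x) \<partial>M)) / 2 + (\<integral>x. (f x - g x)\<^sup>2 \<partial>M) / 8 \<le> max_log"
    using int integrable_square_diff[OF f(1) g(1)] by simp
  then show ?thesis by argo
qed

lemma maximizer_unique:
  assumes f: "f \<in> VP_closure M I" "log_integrable M f" "(\<integral>x. ln (f x) \<partial>M) = max_log"
    and g: "g \<in> VP_closure M I" "log_integrable M g" "(\<integral>x. ln (g x) \<partial>M) = max_log"
  shows "AE x in M. f x = g x"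
proof -
  have "(\<integral>x. (f x - g x)\<^sup>2 \<partial>M) \<le> 0"
    using integral_square_diff_le[OF f(1,2) g(1,2)] f g by simp
  then have "(\<integral>x. (f x - g x)\<^sup>2 \<partial>M) = 0" by (simp add: order_antisym)
  then have "AE x in M. (f x - g x)\<^sup>2 = 0"
    using integral_nonneg_eq_0_iff_AE[OF integrable_square_diff[OF f(1) g(1)]] by simp
  then show ?thesis by simp
qed

text \<open>A maximising sequence with errors \<open>(1 / 4) ^ n\<close> has squared
  \<open>L2\<close> steps of at most \<open>8 * (1 / 4) ^ n\<close>, hence summable
  \<open>L1\<close> steps, hence converges almost everywhere. Dominated convergence puts the limit
  in the closure, and Fatou's lemma bounds its log-integral from below.\<close>

lemma maximizer_exists:
  obtains a where "a \<in> VP_closure M I" "log_integrable M a" "(\<integral>x. ln (a x) \<partial>M) = max_log"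
    "\<And>x. 0 \<le> a x \<and> a x \<le> 1"
proof -
  have "\<exists>f. f \<in> VP I \<and> log_integrable M f \<and> max_log - (1 / 4) ^ n < (\<integral>x. ln (f x) \<partial>M)" for n :: nat
    using VP_log_integral_approx[of "(1 / 4) ^ n"] by auto
  then obtain f where f: "\<And>n::nat. f n \<in> VP I" "\<And>n. log_integrable M (f n)"
    "\<And>n. max_log - (1 / 4) ^ n < (\<integral>x. ln (f n x) \<partial>M)"
    by metis
  note fc = subsetD[OF VP_subset_closure f(1)]
  note [measurable] = VP_measurable[OF f(1)]
  note [simp] = VP_integrable[OF f(1)]
  have step: "(\<integral>x. \<bar>f (Suc n) x - f n x\<bar> \<partial>M) \<le> 9 * (1 / 2) ^ n" for n
  proof -
    have "(\<integral>x. (f (Suc n) x - f n x)\<^sup>2 \<partial>M) \<le> 8 * (1 / 4) ^ n"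
    proof -
      have "(1 / 4 :: real) ^ Suc n \<le> (1 / 4) ^ n" by simp
      then show ?thesis
        using integral_square_diff_le[OF fc f(2) fc f(2), of "Suc n" n] f(3)[of n] f(3)[of "Suc n"]
        by argo
    qed
    \<comment> \<open>The pointwise bound is \<open>y \<le> s + y * y / s\<close> with
      \<open>s = (1 / 2) ^ n\<close>, the scale that balances both terms against the squared bound
      \<open>8 * (1 / 4) ^ n\<close>.\<close>
    have "(\<integral>x. \<bar>f (Suc n) x - f n x\<bar> \<partial>M) \<le> (\<integral>x. (1 / 2) ^ n + 2 ^ n * (f (Suc n) x - f n x)\<^sup>2 \<partial>M)"
    proof (intro integral_mono)
      fix x
      define s :: real where "s = (1 / 2) ^ n"
      have s: "0 < s" "2 ^ n = 1 / s" by (auto simp: s_def power_one_over)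
      define y where "y = \<bar>f (Suc n) x - f n x\<bar>"
      have "0 \<le> (y - s)\<^sup>2 + s * y" using s by (simp add: y_def)
      then have "y * s \<le> s\<^sup>2 + y\<^sup>2" by (simp add: power2_eq_square algebra_simps)
      then have "y \<le> s + (1 / s) * y\<^sup>2" using s by (simp add: field_simps power2_eq_square)
      then show "\<bar>f (Suc n) x - f n x\<bar> \<le> (1 / 2) ^ n + 2 ^ n * (f (Suc n) x - f n x)\<^sup>2"
        unfolding s(2) unfolding y_def s_def by simp
    qed (use integrable_square_diff[OF fc fc] in auto)
    also have "\<dots> = (1 / 2) ^ n + 2 ^ n * (\<integral>x. (f (Suc n) x - f n x)\<^sup>2 \<partial>M)"
      using integrable_square_diff[OF fc fc] by (simp add: prob_space)
    also have "\<dots> \<le> (1 / 2) ^ n + 2 ^ n * (8 * (1 / 4) ^ n)"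
      by (intro add_left_mono mult_left_mono \<open>_ \<le> 8 * (1 / 4) ^ n\<close>) simp
    also have "\<dots> = 9 * (1 / 2) ^ n"
    proof -
      have "(2::real) ^ n * (1 / 4) ^ n = (1 / 2) ^ n" by (simp add: power_mult_distrib[symmetric])
      then show ?thesis by simp
    qed
    finally show ?thesis .
  qed
  have "(\<integral>\<^sup>+x. (\<Sum>n. ennreal \<bar>f (Suc n) x - f n x\<bar>) \<partial>M)
      = (\<Sum>n. \<integral>\<^sup>+x. ennreal \<bar>f (Suc n) x - f n x\<bar> \<partial>M)"
    by (intro nn_integral_suminf) auto
  also have "\<dots> = (\<Sum>n. ennreal (\<integral>x. \<bar>f (Suc n) x - f n x\<bar> \<partial>M))"
    by (simp add: nn_integral_eq_integral)
  also have "\<dots> \<le> (\<Sum>n. ennreal (9 * (1 / 2) ^ n))"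
    by (intro suminf_le ennreal_leI step) auto
  also have "\<dots> = ennreal (\<Sum>n. 9 * (1 / 2) ^ n)"
    by (intro suminf_ennreal2) (auto intro!: summable_mult summable_geometric)
  finally have "(\<integral>\<^sup>+x. (\<Sum>n. ennreal \<bar>f (Suc n) x - f n x\<bar>) \<partial>M) < \<infinity>"
    by (rule le_less_trans) simp
  then have "AE x in M. (\<Sum>n. ennreal \<bar>f (Suc n) x - f n x\<bar>) \<noteq> \<infinity>"
    by (intro nn_integral_PInf_AE) auto
  then have conv: "AE x in M. convergent (\<lambda>n. f n x)"
  proof eventually_elim
    case (elim x)
    have "summable (\<lambda>n. \<bar>f (Suc n) x - f n x\<bar>)"
      using elim by (intro summable_suminf_not_top) auto
    then have "summable (\<lambda>n. f (Suc n) x - f n x)" by (rule summable_rabs_cancel)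
    then have "convergent (\<lambda>n. f n x - f 0 x)"
      unfolding summable_iff_convergent sum_lessThan_telescope[of "\<lambda>n. f n x"]
      .
    then show ?case by (simp add: convergent_diff_const_right_iff)
  qed
  \<comment> \<open>Clamping gives the bounds at every point, also where the sequence diverges and
    \<open>lim\<close> is unspecified.\<close>
  define a where "a = (\<lambda>x. max 0 (min 1 (lim (\<lambda>n. f n x))))"
  have [measurable]: "a \<in> borel_measurable M" unfolding a_def by measurable
  have lim: "AE x in M. (\<lambda>n. f n x) \<longlonglongrightarrow> a x"
    using conv
  proof eventually_elim
    case (elim x)
    then have l: "(\<lambda>n. f n x) \<longlonglongrightarrow> lim (\<lambda>n. f n x)" by (simp add: convergent_LIMSEQ_iff)
    have "0 \<le> lim (\<lambda>n. f n x)" by (rule LIMSEQ_le_const[OF l]) (auto simp: VP_bounds[OF f(1)])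
    moreover have "lim (\<lambda>n. f n x) \<le> 1" by (rule LIMSEQ_le_const2[OF l]) (auto simp: VP_bounds[OF f(1)])
    ultimately show ?case using l by (simp add: a_def)
  qed
  have bnd: "0 \<le> a x \<and> a x \<le> 1" for x by (simp add: a_def)
  have ai: "integrable M a" by (rule integrable_const_bound[of _ 1]) (use bnd in auto)
  have L1: "(\<lambda>n. \<integral>x. \<bar>a x - f n x\<bar> \<partial>M) \<longlonglongrightarrow> (\<integral>x. 0 \<partial>M)"
  proof (rule integral_dominated_convergence[where w = "\<lambda>_. 1"])
    show "AE x in M. (\<lambda>n. \<bar>a x - f n x\<bar>) \<longlonglongrightarrow> 0"
      using lim
    proof eventually_elim
      case (elim x)
      show ?case using tendsto_rabs[OF tendsto_diff[OF tendsto_const elim, of "a x"]] by simp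
    qed
    show "AE x in M. norm \<bar>a x - f n x\<bar> \<le> 1" for n
    proof (rule AE_I2)
      fix x show "norm \<bar>a x - f n x\<bar> \<le> 1"
        using bnd[of x] VP_bounds[OF f(1), of n x] by (simp add: abs_le_iff)
    qed
  qed auto
  have ac: "a \<in> VP_closure M I"
    unfolding VP_closure_def
  proof (safe intro!: ai)
    fix e :: real assume "0 < e"
    have "\<forall>\<^sub>F n in sequentially. (\<integral>x. \<bar>a x - f n x\<bar> \<partial>M) < e"
      using order_tendstoD(2)[OF L1, of e] \<open>0 < e\<close> by simp
    then obtain n where "(\<integral>x. \<bar>a x - f n x\<bar> \<partial>M) < e" by (auto simp: eventually_sequentially)
    then show "\<exists>g\<in>VP I. (\<integral>x. \<bar>a x - g x\<bar> \<partial>M) < e" using f(1) by auto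
  qed
  let ?G = "\<lambda>y::real. if y \<le> 0 then top else ennreal (- ln y)"
  have pos: "AE x in M. \<forall>n. 0 < f n x" using f(2) by (simp add: log_integrable_def AE_all_countable)
  have "(\<integral>\<^sup>+x. ?G (a x) \<partial>M) \<le> (\<integral>\<^sup>+x. liminf (\<lambda>n. ennreal (- ln (f n x))) \<partial>M)"
  proof (intro nn_integral_mono_AE)
    show "AE x in M. ?G (a x) \<le> liminf (\<lambda>n. ennreal (- ln (f n x)))"
      using pos lim
    proof eventually_elim
      case (elim x)
      \<comment> \<open>With the value \<open>top\<close> at 0, minus the logarithm is continuous up
        to 0 from the right. So Fatou's lemma also covers points where \<open>a\<close> vanishes,
        and the finite bound then shows that they form a null set.\<close>
      have "(\<lambda>n. ennreal (- ln (f n x))) \<longlonglongrightarrow> ?G (a x)"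
      proof (cases "a x \<le> 0")
        case True
        then have "a x = 0" using bnd[of x] by simp
        then have "filterlim (\<lambda>n. f n x) (at_right 0) sequentially"
          using elim by (intro tendsto_imp_filterlim_at_right) auto
        then have "filterlim (\<lambda>n. - ln (f n x)) at_top sequentially"
          unfolding filterlim_uminus_at_top
          by (simp add: filterlim_compose[OF ln_at_0])
        then show ?thesis using True by (simp add: ennreal_tendsto_top_eq_at_top)
      next
        case False
        then show ?thesis using elim by (auto intro!: tendsto_ennrealI tendsto_minus tendsto_ln)
      qed
      then show ?case by (simp add: lim_imp_Liminf)
    qed
  qed
  also have "\<dots> \<le> liminf (\<lambda>n. \<integral>\<^sup>+x. ennreal (- ln (f n x)) \<partial>M)"
    by (intro nn_integral_liminf) auto
  also have "\<dots> \<le> liminf (\<lambda>n. ennreal (- max_log + (1 / 4) ^ n))"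
  proof (intro Liminf_mono always_eventually allI)
    fix n
    have "(\<integral>\<^sup>+x. ennreal (- ln (f n x)) \<partial>M) = ennreal (\<integral>x. - ln (f n x) \<partial>M)"
      using f(2)[of n] VP_bounds[OF f(1)[of n]]
      by (intro nn_integral_eq_integral) (auto simp: log_integrable_def elim!: eventually_mono)
    also have "\<dots> \<le> ennreal (- max_log + (1 / 4) ^ n)"
      using f(3)[of n] by (intro ennreal_leI) simp
    finally show "(\<integral>\<^sup>+x. ennreal (- ln (f n x)) \<partial>M) \<le> ennreal (- max_log + (1 / 4) ^ n)" .
  qed
  also have "(\<lambda>n. ennreal (- max_log + (1 / 4) ^ n)) \<longlonglongrightarrow> ennreal (- max_log + 0)"
    by (intro tendsto_ennrealI tendsto_add tendsto_const LIMSEQ_realpow_zero) auto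
  then have "liminf (\<lambda>n. ennreal (- max_log + (1 / 4) ^ n)) = ennreal (- max_log)"
    by (simp add: lim_imp_Liminf)
  finally have le: "(\<integral>\<^sup>+x. ?G (a x) \<partial>M) \<le> ennreal (- max_log)" .
  have la: "log_integrable M a"
    using bnd le by (intro log_integrableI_nn_integral) (auto intro: le_less_trans)
  have "ereal (- (\<integral>x. ln (a x) \<partial>M)) = phi M a"
    using la bnd by (intro phi_log_integrable[symmetric]) auto
  also have "\<dots> \<le> enn2ereal (ennreal (- max_log))"
    using bnd le by (subst phi_eq_nn_integral) (auto simp: less_eq_ennreal.rep_eq)
  also have "\<dots> = ereal (- max_log)" using max_log_nonpos by (simp add: enn2ereal_ennreal)
  finally have "max_log \<le> (\<integral>x. ln (a x) \<partial>M)" by simp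
  then have "(\<integral>x. ln (a x) \<partial>M) = max_log"
    using closure_log_integral_le[OF ac la] by simp
  with ac la show ?thesis using bnd by (rule that)
qed

end

section \<open>Entropy\<close>

context covered_system
begin

text \<open>The first-order optimality condition \<open>\<integral>\<^sub>J 1/a \<le> 1\<close>, in a form that avoids small values of \<open>a\<close>:
  comparing \<open>a\<close> with \<open>c = (1 - t) a + t 1\<^sub>J\<close> and using \<open>ln c - ln a \<ge> 1 - a / c\<close>.\<close>

lemma maximizer_dual:
  assumes a: "a \<in> VP_closure M I" "log_integrable M a" "(\<integral>x. ln (a x) \<partial>M) = max_log"
    and bnd: "\<And>x. 0 \<le> a x \<and> a x \<le> 1" and t: "0 < t" "t < 1" and J: "J \<in> I"
  shows "(\<integral>\<^sup>+x. ennreal ((1 - t) / (a x + t) * indicator J x) \<partial>M) \<le> 1"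
proof -
  define c where "c = (\<lambda>x. (1 - t) * a x + t * indicator J x)"
  have Jm[measurable]: "J \<in> sets M" using J I by auto
  have am[measurable]: "a \<in> borel_measurable M" using closure_measurable[OF a(1)] .
  have c: "c \<in> VP_closure M I"
    unfolding c_def using t indicator_in_VP[OF J] VP_subset_closure
    by (intro closure_convex a) auto
  have ge: "(1 - t) * a x \<le> c x" for x using t by (simp add: c_def)
  have lc: "log_integrable M c"
  proof (rule log_integrable_mono[OF closure_measurable[OF c] a(2)])
    show "AE x in M. (1 - t) * a x \<le> c x" using ge by simp
    show "AE x in M. c x \<le> 1" using closure_bounds[OF c] by eventually_elim simp
  qed (use t finite_measure_axioms in auto)
  have int: "integrable M (\<lambda>x. ln (a x))" "integrable M (\<lambda>x. ln (c x))"
    using a(2) lc by (auto simp: log_integrable_def)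
  have pos: "AE x in M. 0 < a x" using a(2) by (auto simp: log_integrable_def)
  have ig: "integrable M (\<lambda>x. (1 - t) / (a x + t) * indicator J x)"
  proof (rule integrable_const_bound[of _ "1 / t"])
    have "(1 - t) / (a x + t) \<le> 1 / t" for x
      using t bnd[of x] by (intro frac_le) auto
    then show "AE x in M. norm ((1 - t) / (a x + t) * indicator J x) \<le> 1 / t"
      using t bnd by (auto simp: indicator_def)
  qed simp
  have "(\<integral>x. (1 - t) / (a x + t) * indicator J x \<partial>M) \<le> (\<integral>x. 1 + (1 - t) / t * (ln (c x) - ln (a x)) \<partial>M)"
  proof (intro integral_mono_AE ig)
    show "AE x in M. (1 - t) / (a x + t) * indicator J x \<le> 1 + (1 - t) / t * (ln (c x) - ln (a x))"
      using pos
    proof eventually_elim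
      case (elim x)
      have cx: "0 < c x" using less_le_trans[OF mult_pos_pos ge[of x]] elim t by simp
      have "1 - a x / c x \<le> ln (c x) - ln (a x)"
        using ln_le_minus_one[of "a x / c x"] cx elim by (simp add: ln_div)
      then have "(1 - t) / t * (1 - a x / c x) \<le> (1 - t) / t * (ln (c x) - ln (a x))"
        using t by (intro mult_left_mono) auto
      \<comment> \<open>This uses \<open>c x - a x = t * (indicator J x - a x)\<close>. The
        subtracted term on the right is at most 1, which is the 1 in the final bound.\<close>
      moreover have "(1 - t) / t * (1 - a x / c x) = (1 - t) * indicator J x / c x - (1 - t) * a x / c x"
      proof -
        have "1 - a x / c x = (c x - a x) / c x" using cx by (simp add: diff_divide_distrib)
        also have "c x - a x = t * (indicator J x - a x)" by (simp add: c_def algebra_simps)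
        finally have "(1 - t) / t * (1 - a x / c x) = (1 - t) / t * (t * (indicator J x - a x) / c x)" by simp
        also have "\<dots> = (1 - t) * (indicator J x - a x) / c x" using t by simp
        also have "\<dots> = (1 - t) * indicator J x / c x - (1 - t) * a x / c x"
          by (simp only: right_diff_distrib diff_divide_distrib)
        finally show ?thesis .
      qed
      moreover have "(1 - t) * a x / c x \<le> 1" using ge[of x] cx by simp
      \<comment> \<open>On \<open>J\<close>,
        \<open>c x = (1 - t) * a x + t \<le> a x + t\<close>.\<close>
      moreover have "(1 - t) / (a x + t) * indicator J x \<le> (1 - t) * indicator J x / c x"
      proof (cases "x \<in> J")
        case True
        have "(1 - t) * a x \<le> a x" using t elim by (simp add: mult_left_le_one_le)
        then show ?thesis using True t cx elim
          by (simp add: c_def) (intro divide_left_mono mult_pos_pos, auto)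
      qed simp
      ultimately show ?case by linarith
    qed
  qed (use int in auto)
  also have "\<dots> = 1 + (1 - t) / t * ((\<integral>x. ln (c x) \<partial>M) - (\<integral>x. ln (a x) \<partial>M))"
    using int by (simp add: prob_space)
  also have "\<dots> \<le> 1"
  proof -
    have "(\<integral>x. ln (c x) \<partial>M) - (\<integral>x. ln (a x) \<partial>M) \<le> 0"
      using closure_log_integral_le[OF c lc] a(3) by simp
    then have "(1 - t) / t * ((\<integral>x. ln (c x) \<partial>M) - (\<integral>x. ln (a x) \<partial>M)) \<le> 0"
      using t by (intro mult_nonneg_nonpos) auto
    then show ?thesis by simp
  qed
  finally have "(\<integral>x. (1 - t) / (a x + t) * indicator J x \<partial>M) \<le> 1" .
  moreover have "(\<integral>\<^sup>+x. ennreal ((1 - t) / (a x + t) * indicator J x) \<partial>M)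
      = ennreal (\<integral>x. (1 - t) / (a x + t) * indicator J x \<partial>M)"
    using ig t bnd by (intro nn_integral_eq_integral AE_I2) (auto intro!: mult_nonneg_nonneg divide_nonneg_nonneg)
  ultimately show ?thesis by simp
qed

text \<open>Dominated convergence with \<open>t = 1 / (n + 2)\<close> tending to 0. The shift by 2
  keeps \<open>t \<le> 1 / 2\<close>, so that \<open>ln (1 - t)\<close> and the positive part of
  \<open>ln (a x + t)\<close> are each at most \<open>ln 2\<close> in absolute value.\<close>

lemma dual_log_integral_tendsto:
  assumes a: "a \<in> borel_measurable M" "log_integrable M a" and bnd: "\<And>x. 0 \<le> a x \<and> a x \<le> 1"
  shows "(\<lambda>n. \<integral>x. ln ((1 - 1 / (real n + 2)) / (a x + 1 / (real n + 2))) \<partial>M) \<longlonglongrightarrow> (\<integral>x. - ln (a x) \<partial>M)"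
proof (rule integral_dominated_convergence[where w = "\<lambda>x. \<bar>ln (a x)\<bar> + 2 * ln 2"])
  have lim: "(\<lambda>n. 1 / (real n + 2)) \<longlonglongrightarrow> 0" by real_asymp
  have pos: "AE x in M. 0 < a x" and int: "integrable M (\<lambda>x. ln (a x))"
    using a by (auto simp: log_integrable_def)
  show "integrable M (\<lambda>x. \<bar>ln (a x)\<bar> + 2 * ln 2)" using int by simp
  show "AE x in M. (\<lambda>n. ln ((1 - 1 / (real n + 2)) / (a x + 1 / (real n + 2)))) \<longlonglongrightarrow> - ln (a x)"
    using pos
  proof eventually_elim
    case (elim x)
    have "(\<lambda>n. ln ((1 - 1 / (real n + 2)) / (a x + 1 / (real n + 2)))) \<longlonglongrightarrow> ln ((1 - 0) / (a x + 0))"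
      using elim by (intro tendsto_intros lim) auto
    then show ?case using elim by (simp add: ln_div)
  qed
  show "AE x in M. norm (ln ((1 - 1 / (real n + 2)) / (a x + 1 / (real n + 2)))) \<le> \<bar>ln (a x)\<bar> + 2 * ln 2" for n
    using pos
  proof eventually_elim
    case (elim x)
    define t where "t = 1 / (real n + 2)"
    have t: "0 < t" "t \<le> 1 / 2" by (auto simp: t_def field_simps)
    have "ln (1 / 2) \<le> ln (1 - t)" using t by (subst ln_le_cancel_iff) auto
    moreover have "ln (1 - t) \<le> 0" using t by simp
    moreover have "ln (a x) \<le> ln (a x + t)" using t elim by (subst ln_le_cancel_iff) auto
    moreover have "ln (a x + t) \<le> ln 2" using t elim bnd[of x] by (subst ln_le_cancel_iff) auto
    moreover have "ln ((1 - t) / (a x + t)) = ln (1 - t) - ln (a x + t)"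
      using t elim by (simp add: ln_div)
    moreover have "ln (1 / 2 :: real) = - ln 2" by (simp add: ln_div)
    moreover have "0 < ln (2::real)" by simp
    ultimately have "norm (ln ((1 - t) / (a x + t))) \<le> \<bar>ln (a x)\<bar> + 2 * ln 2" by (simp only: real_norm_def abs_le_iff) linarith
    then show ?case by (simp add: t_def)
  qed
qed (use a in auto)

section \<open>Exponential bounds on the number of boxes\<close>

text \<open>Off an exceptional set of measure below \<open>(1 - lam) / 2\<close>, the product of the
  bounded dual function \<open>g\<close> is at least \<open>K\<close>. A cover of measure
  \<open>1 - lam\<close> keeps at least half of that measure off the exceptional set, and
  \<open>boxes_needed\<close> applies. One half of \<open>e\<close> pays for replacing
  \<open>1 / a\<close> by \<open>g\<close>, the other for the deviation from the mean.\<close>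

lemma box_count_lower_bound:
  assumes a: "a \<in> VP_closure M I" "log_integrable M a" "(\<integral>x. ln (a x) \<partial>M) = max_log"
    and bnd: "\<And>x. 0 \<le> a x \<and> a x \<le> 1" and "0 < e" and lam: "lam < 1"
  shows "\<forall>\<^sub>F l in sequentially. \<forall>B. finite B \<and> B \<subseteq> boxes l I \<and>
           measure (PiM {..<l} (\<lambda>_. M)) (\<Union>B) \<ge> 1 - lam \<longrightarrow>
           (1 - lam) / 2 * exp (real l * (- max_log - e)) \<le> real (card B)"
proof -
  note [measurable] = closure_measurable[OF a(1)]
  have "\<forall>\<^sub>F n in sequentially. (\<integral>x. - ln (a x) \<partial>M) - e / 2
      < (\<integral>x. ln ((1 - 1 / (real n + 2)) / (a x + 1 / (real n + 2))) \<partial>M)"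
    using \<open>0 < e\<close>
    by (intro order_tendstoD(1)[OF dual_log_integral_tendsto[OF closure_measurable[OF a(1)] a(2) bnd]]) auto
  then obtain n where n: "(\<integral>x. - ln (a x) \<partial>M) - e / 2
      < (\<integral>x. ln ((1 - 1 / (real n + 2)) / (a x + 1 / (real n + 2))) \<partial>M)"
    by (auto simp: eventually_sequentially)
  define t where "t = 1 / (real n + 2)"
  have t: "0 < t" "t < 1" by (auto simp: t_def field_simps)
  define g where "g = (\<lambda>x. (1 - t) / (a x + t))"
  have [measurable]: "g \<in> borel_measurable M" unfolding g_def by measurable
  have at: "0 < a x + t" for x using bnd[of x] t by simp
  have g0: "0 < g x" for x using t at by (simp add: g_def)
  have Eg: "- max_log - e / 2 < (\<integral>x. ln (g x) \<partial>M)"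
    using n a(3) by (simp add: g_def t_def)
  \<comment> \<open>The extra 1 makes \<open>lo < hi\<close> strict, as the weak law
    requires.\<close>
  define lo where "lo = - ln (1 / t) - 1"
  define hi where "hi = - ln ((1 - t) / (1 + t))"
  have gb: "- ln (g x) \<in> {lo..hi}" for x
  proof -
    have "(1 - t) / (1 + t) \<le> g x" "g x \<le> 1 / t"
      unfolding g_def using t at bnd[of x] by (auto intro!: divide_left_mono mult_pos_pos frac_le)
    then have "ln ((1 - t) / (1 + t)) \<le> ln (g x)" "ln (g x) \<le> ln (1 / t)"
      using t g0[of x] by (auto intro!: ln_mono)
    then show ?thesis by (auto simp: lo_def hi_def)
  qed
  have lohi: "lo < hi"
  proof -
    have "(1 - t) / (1 + t) \<le> 1 / t" using t by (intro frac_le) auto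
    then have "ln ((1 - t) / (1 + t)) \<le> ln (1 / t)" using t by (intro ln_mono) auto
    then show ?thesis by (simp add: lo_def hi_def)
  qed
  define P where "P = (\<lambda>l::nat. PiM {..<l} (\<lambda>_. M))"
  define Bad where "Bad = (\<lambda>l. {x \<in> space (P l). real l * (expectation (\<lambda>x. - ln (g x)) + e / 2) \<le> (\<Sum>i<l. - ln (g (x i)))})"
  have "(\<lambda>l. measure (P l) (Bad l)) \<longlonglongrightarrow> 0"
    unfolding P_def Bad_def
    by (rule weak_law_upper_tail[where lo = lo and hi = hi]) (use gb lohi \<open>0 < e\<close> in auto)
  then have "\<forall>\<^sub>F l in sequentially. measure (P l) (Bad l) < (1 - lam) / 2"
    using lam by (intro order_tendstoD) auto
  then show ?thesis
  proof eventually_elim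
    case (elim l)
    interpret P: prob_space "P l" unfolding P_def by (intro prob_space_PiM prob_space_axioms)
    show ?case
    proof (safe)
      fix B assume B: "finite B" "B \<subseteq> boxes l I" "1 - lam \<le> measure (PiM {..<l} (\<lambda>_. M)) (\<Union>B)"
      have UB: "\<Union>B \<in> sets (P l)"
        using B sets_box[OF I] unfolding P_def by (intro sets.finite_Union) auto
      have Bad: "Bad l \<in> sets (P l)" unfolding Bad_def P_def by measurable
      define T where "T = space (P l) - Bad l"
      have T: "T \<in> sets (P l)" using Bad by (auto simp: T_def)
      define K where "K = exp (real l * (- max_log - e))"
      have "K \<le> (\<Prod>i<l. g (x i))" if "x \<in> T" for x
      proof -
        have "(\<Sum>i<l. - ln (g (x i))) < real l * (expectation (\<lambda>x. - ln (g x)) + e / 2)"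
          using that by (auto simp: T_def Bad_def)
        also have "\<dots> \<le> real l * (max_log + e)"
          using Eg by (intro mult_left_mono) auto
        finally have "real l * (- max_log - e) \<le> (\<Sum>i<l. ln (g (x i)))"
          by (simp add: sum_negf algebra_simps)
        then have "K \<le> exp (\<Sum>i<l. ln (g (x i)))" by (simp add: K_def)
        also have "\<dots> = (\<Prod>i<l. g (x i))" using g0 by (simp add: exp_sum)
        finally show ?thesis .
      qed
      then have le: "K * P.prob (T \<inter> \<Union>B) \<le> card B"
        unfolding P_def using maximizer_dual[OF a bnd t] less_imp_le[OF g0] T B(1,2)
        by (intro boxes_needed[OF I, where g = g]) (auto simp: g_def K_def P_def)
      have "P.prob (\<Union>B) \<le> P.prob (T \<inter> \<Union>B) + P.prob (Bad l)"
        using UB T Bad sets.sets_into_space[OF UB]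
        by (intro order_trans[OF P.finite_measure_mono measure_Un_le]) (auto simp: T_def)
      then have "(1 - lam) / 2 \<le> P.prob (T \<inter> \<Union>B)"
        using elim B(3) by (simp add: P_def)
      then have "(1 - lam) / 2 * K \<le> P.prob (T \<inter> \<Union>B) * K"
        by (intro mult_right_mono) (auto simp: K_def)
      also note mult.commute
      also note le
      finally show "(1 - lam) / 2 * exp (real l * (- max_log - e)) \<le> real (card B)"
        by (simp add: K_def)
    qed
  qed
qed

text \<open>The greedy cover is run on the set \<open>R\<close> where the product of
  \<open>f\<close> is at least \<open>c\<close>. It leaves at most \<open>lam / 2\<close> of
  \<open>R\<close> uncovered, and the complement of \<open>R\<close> has measure at most
  \<open>lam / 2\<close> by the weak law. The error \<open>e\<close> is split between the choice of
  \<open>f\<close> and the deviation from the mean.\<close>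

lemma box_count_upper_bound:
  assumes a: "a \<in> VP_closure M I" "log_integrable M a" "(\<integral>x. ln (a x) \<partial>M) = max_log"
    and "0 < e" and lam: "0 < lam"
  shows "\<exists>C>0. \<forall>\<^sub>F l in sequentially. \<exists>B. finite B \<and> B \<subseteq> boxes l I \<and>
           measure (PiM {..<l} (\<lambda>_. M)) (\<Union>B) \<ge> 1 - lam \<and>
           real (card B) \<le> C * exp (real l * (- max_log + e))"
proof -
  obtain f d where f: "f \<in> VP I" "0 < d" "AE x in M. d \<le> f x"
    "(\<integral>x. ln (a x) \<partial>M) - e / 2 \<le> (\<integral>x. ln (f x) \<partial>M)"
    using VP_bounded_approx[OF a(1,2), of "e / 2"] \<open>0 < e\<close> by auto
  note [measurable] = VP_measurable[OF f(1)]
  obtain n :: nat and q J where qJ: "\<forall>k<n. J k \<in> I \<and> 0 \<le> q k" "(\<Sum>k<n. q k) = 1"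
    "f = (\<lambda>x. \<Sum>k<n. q k * indicator (J k) x)"
    by (rule VP_E[OF f(1)]) (rule that, assumption+)
  define P where "P = (\<lambda>l::nat. PiM {..<l} (\<lambda>_. M))"
  define Bad where "Bad = (\<lambda>l. {x \<in> space (P l). real l * (expectation (\<lambda>x. - ln (f x)) + e / 2) \<le> (\<Sum>i<l. - ln (f (x i)))})"
  have "(\<lambda>l. measure (P l) (Bad l)) \<longlonglongrightarrow> 0"
    unfolding P_def Bad_def
  proof (rule weak_law_upper_tail[where lo = "-1" and hi = "max 0 (- ln d)"])
    show "AE x in M. - ln (f x) \<in> {-1..max 0 (- ln d)}"
      using f(3)
    proof eventually_elim
      case (elim x)
      then have "ln d \<le> ln (f x)" "ln (f x) \<le> 0" using f(2) VP_bounds(2)[OF f(1), of x] by auto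
      then show ?case by auto
    qed
  qed (use \<open>0 < e\<close> in auto)
  then have Bad_small: "\<forall>\<^sub>F l in sequentially. measure (P l) (Bad l) < lam / 2"
    using lam by (intro order_tendstoD) auto
  \<comment> \<open>After \<open>D / c\<close> boxes the remainder is at most
    \<open>exp (- D) \<le> lam / 2\<close>. The lower bound 1 on \<open>D\<close> ensures that
    rounding \<open>D * E\<close> up at most doubles it.\<close>
  define D where "D = max 1 (- ln (lam / 2))"
  have D: "1 \<le> D" "exp (- D) \<le> lam / 2"
  proof -
    have "exp (- D) \<le> exp (ln (lam / 2))" by (subst exp_le_cancel_iff) (simp add: D_def)
    then show "exp (- D) \<le> lam / 2" using lam by simp
  qed (simp add: D_def)
  have "\<forall>\<^sub>F l in sequentially. \<exists>B. finite B \<and> B \<subseteq> boxes l I \<and>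
           measure (PiM {..<l} (\<lambda>_. M)) (\<Union>B) \<ge> 1 - lam \<and>
           real (card B) \<le> 2 * D * exp (real l * (- max_log + e))"
    using Bad_small
  proof eventually_elim
    case (elim l)
    interpret P: prob_space "P l" unfolding P_def by (intro prob_space_PiM prob_space_axioms)
    define E where "E = exp (real l * (- max_log + e))"
    have E1: "1 \<le> E" using max_log_nonpos \<open>0 < e\<close> by (simp add: E_def)
    define c where "c = 1 / E"
    have c: "0 < c" "c \<le> 1" using E1 by (auto simp: c_def)
    have Bad: "Bad l \<in> sets (P l)" unfolding Bad_def P_def by measurable
    define R where "R = {x \<in> space (P l). c \<le> (\<Prod>i<l. f (x i))}"
    have R: "R \<in> sets (P l)" unfolding R_def P_def by measurable
    \<comment> \<open>The product is the exponential of the sum of logarithms only where all factors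
      are positive, which holds almost everywhere. So the complement of \<open>R\<close> lies in
      \<open>Bad l\<close> up to a null set.\<close>
    have "AE x in P l. \<forall>i\<in>{..<l}. d \<le> f (x i)"
      unfolding P_def using f(3)
      by (intro AE_ball_countable[THEN iffD2] ballI AE_PiM_component[where M = "\<lambda>_. M"] prob_space_axioms)
         (auto intro: countable_finite)
    then have "AE x in P l. x \<in> space (P l) - R \<longrightarrow> x \<in> Bad l"
    proof eventually_elim
      case (elim x)
      show ?case
      proof (rule impI, rule ccontr)
        assume x: "x \<in> space (P l) - R" "x \<notin> Bad l"
        have "(\<Sum>i<l. - ln (f (x i))) < real l * (expectation (\<lambda>x. - ln (f x)) + e / 2)"
          using x by (auto simp: Bad_def)
        also have "\<dots> \<le> real l * (- max_log + e)"
          using f(4) a(3) by (intro mult_left_mono) auto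
        finally have "- (real l * (- max_log + e)) \<le> (\<Sum>i<l. ln (f (x i)))"
          by (simp add: sum_negf)
        moreover have "c = exp (- (real l * (- max_log + e)))"
          by (simp only: c_def E_def exp_minus inverse_eq_divide)
        ultimately have "c \<le> exp (\<Sum>i<l. ln (f (x i)))" by simp
        also have "\<dots> = (\<Prod>i<l. f (x i))"
        proof -
          have "0 < f (x i)" if "i < l" for i using elim that f(2) by force
          then show ?thesis by (simp add: exp_sum)
        qed
        finally show False using x by (simp add: R_def)
      qed
    qed
    then have co: "P.prob (space (P l) - R) \<le> P.prob (Bad l)"
      using Bad by (intro P.finite_measure_mono_AE) auto
    define N where "N = nat \<lceil>D * E\<rceil>"
    have DE: "1 \<le> D * E" using D E1 by (metis mult_mono' mult_1 zero_le_one)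
    have N: "D * E \<le> real N" "real N \<le> 2 * D * E" using DE by (auto simp: N_def) linarith+
    have "\<exists>B. finite B \<and> B \<subseteq> boxes l I \<and> card B \<le> N \<and> P.prob (R - \<Union>B) \<le> (1 - c) ^ N"
      unfolding P_def
      by (rule exists_boxes_covering[OF I, where J = J and q = q and n = n])
         (use qJ R c in \<open>auto simp: R_def P_def simp del: sum_mult_indicator\<close>)
    then obtain B where B: "finite B" "B \<subseteq> boxes l I" "card B \<le> N" "P.prob (R - \<Union>B) \<le> (1 - c) ^ N"
      by blast
    have UB: "\<Union>B \<in> sets (P l)"
      using B sets_box[OF I] unfolding P_def by (intro sets.finite_Union) auto
    have "(1 - c) ^ N \<le> exp (- c) ^ N"
      using c exp_ge_add_one_self[of "- c"] by (intro power_mono) auto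
    also have "\<dots> = exp (- (c * real N))" by (simp add: exp_of_nat_mult[symmetric] mult.commute)
    also have "\<dots> \<le> exp (- D)"
      using N(1) E1 by (simp add: c_def pos_le_divide_eq)
    finally have "P.prob (R - \<Union>B) \<le> lam / 2" using B(4) D by linarith
    moreover have "P.prob (space (P l) - \<Union>B) \<le> P.prob (R - \<Union>B) + P.prob (space (P l) - R)"
      using UB R by (intro order_trans[OF P.finite_measure_mono measure_Un_le]) auto
    ultimately have "P.prob (space (P l) - \<Union>B) \<le> lam" using co elim by linarith
    then have "1 - lam \<le> P.prob (\<Union>B)" using P.prob_compl[OF UB] by simp
    then show ?case
      using B N(2) by (intro exI[of _ B]) (auto simp: P_def E_def)
  qed
  then show ?thesis using D by (intro exI[of _ "2 * D"]) auto
qed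

section \<open>The growth rate of the box covering number\<close>

lemma box_cover_number_le:
  "finite B \<Longrightarrow> B \<subseteq> boxes l I \<Longrightarrow> measure (PiM {..<l} (\<lambda>_. M)) (\<Union>B) \<ge> 1 - lam \<Longrightarrow>
    box_cover_number l I M lam \<le> enat (card B)"
  unfolding box_cover_number_def by (rule Inf_lower) auto

text \<open>A finite value excludes the empty set, whose infimum is infinite, and a nonempty set of
  extended naturals has a least element.\<close>

lemma box_cover_number_attained:
  assumes "box_cover_number l I M lam = enat k"
  shows "\<exists>B. finite B \<and> B \<subseteq> boxes l I \<and> measure (PiM {..<l} (\<lambda>_. M)) (\<Union>B) \<ge> 1 - lam \<and> card B = k"
proof -
  let ?S = "{enat (card B) | B. finite B \<and> B \<subseteq> boxes l I \<and> measure (PiM {..<l} (\<lambda>_. M)) (\<Union>B) \<ge> 1 - lam}"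
  have "?S \<noteq> {}" using assms unfolding box_cover_number_def by (metis Inf_empty enat.distinct(1) top_enat_def)
  then have "Inf ?S \<in> ?S" 
    unfolding Inf_enat_def by (simp only: if_False) (metis (mono_tags, lifting) LeastI ex_in_conv)
  then show ?thesis using assms unfolding box_cover_number_def by auto
qed

lemma log_box_cover_number_tendsto:
  assumes a: "a \<in> VP_closure M I" "log_integrable M a" "(\<integral>x. ln (a x) \<partial>M) = max_log"
    and bnd: "\<And>x. 0 \<le> a x \<and> a x \<le> 1" and lam: "0 < lam" "lam < 1"
  shows "(\<lambda>l. ereal (1 / real l) * ext_ln (ereal_of_enat (box_cover_number l I M lam))) \<longlonglongrightarrow> ereal (- max_log)"
    (is "?X \<longlonglongrightarrow> _")
proof -
  have main: "\<forall>\<^sub>F l in sequentially. \<exists>y. ?X l = ereal y \<and> \<bar>y + max_log\<bar> < e" if "0 < e" for e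
  proof -
    obtain C where C: "0 < C" "\<forall>\<^sub>F l in sequentially. \<exists>B. finite B \<and> B \<subseteq> boxes l I \<and>
           measure (PiM {..<l} (\<lambda>_. M)) (\<Union>B) \<ge> 1 - lam \<and>
           real (card B) \<le> C * exp (real l * (- max_log + e / 2))"
      using box_count_upper_bound[OF a _ lam(1), of "e / 2"] \<open>0 < e\<close> by auto
    define c where "c = (1 - lam) / 2"
    have c: "0 < c" using lam by (simp add: c_def)
    \<comment> \<open>The constant factors in front of the exponentials disappear once their
      logarithms are divided by \<open>l\<close>.\<close>
    have small: "\<forall>\<^sub>F l in sequentially. \<bar>ln K / real l\<bar> < e / 2" for K
      using \<open>0 < e\<close> by (intro order_tendstoD(2)[of _ 0] tendsto_rabs_zero lim_const_over_n) auto
    have lower: "\<forall>\<^sub>F l in sequentially. \<forall>B. finite B \<and> B \<subseteq> boxes l I \<and>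
           measure (PiM {..<l} (\<lambda>_. M)) (\<Union>B) \<ge> 1 - lam \<longrightarrow>
           (1 - lam) / 2 * exp (real l * (- max_log - e / 2)) \<le> real (card B)"
      using \<open>0 < e\<close> lam by (intro box_count_lower_bound[OF a bnd]) auto
    show ?thesis
      using C(2) lower small[of C] small[of c] eventually_gt_at_top[of 0]
    proof eventually_elim
      case (elim l)
      obtain B where B: "finite B" "B \<subseteq> boxes l I"
        "measure (PiM {..<l} (\<lambda>_. M)) (\<Union>B) \<ge> 1 - lam"
        "real (card B) \<le> C * exp (real l * (- max_log + e / 2))"
        using elim by blast
      have le: "box_cover_number l I M lam \<le> enat (card B)" by (rule box_cover_number_le[OF B(1-3)])
      then obtain k where k: "box_cover_number l I M lam = enat k" by (cases "box_cover_number l I M lam") auto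
      have "real k \<le> C * exp (real l * (- max_log + e / 2))" using le k B(4) by simp
      moreover obtain B' where B': "finite B'" "B' \<subseteq> boxes l I"
        "measure (PiM {..<l} (\<lambda>_. M)) (\<Union>B') \<ge> 1 - lam" "card B' = k"
        using box_cover_number_attained[OF k] by blast
      then have k_ge: "c * exp (real l * (- max_log - e / 2)) \<le> real k"
        using elim(2) lam \<open>0 < e\<close> by (auto simp: c_def)
      moreover have "0 < c * exp (real l * (- max_log - e / 2))" using c by simp
      \<comment> \<open>The lower bound makes \<open>k\<close> positive, so \<open>ext_ln\<close> is
        the ordinary logarithm there.\<close>
      ultimately have k0: "0 < real k"
        and lnk: "ln (c * exp (real l * (- max_log - e / 2))) \<le> ln (real k)"
          "ln (real k) \<le> ln (C * exp (real l * (- max_log + e / 2)))"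
        by (auto intro!: ln_mono)
      have X: "?X l = ereal (ln (real k) / real l)"
        using k0 by (simp add: k ext_ln_def)
      have "ln c / real l + (- max_log - e / 2) \<le> ln (real k) / real l"
        "ln (real k) / real l \<le> ln C / real l + (- max_log + e / 2)"
        using divide_right_mono[OF lnk(1), of "real l"] divide_right_mono[OF lnk(2), of "real l"] c C(1) elim(5)
        by (simp_all add: ln_mult add_divide_distrib)
      then have "\<bar>ln (real k) / real l + max_log\<bar> < e" using elim(3,4) by linarith
      then show ?case using X by blast
    qed
  qed
  have "\<forall>\<^sub>F l in sequentially. ?X l = ereal (real_of_ereal (?X l))"
    using main[OF zero_less_one]
  proof eventually_elim
    case (elim l)
    then obtain y where "?X l = ereal y" by blast
    then show ?case by (simp only: real_of_ereal.simps)
  qed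
  moreover have "(\<lambda>l. real_of_ereal (?X l)) \<longlonglongrightarrow> - max_log"
  proof (rule tendstoI)
    fix e :: real assume "0 < e"
    show "\<forall>\<^sub>F l in sequentially. dist (real_of_ereal (?X l)) (- max_log) < e"
      using main[OF \<open>0 < e\<close>]
    proof eventually_elim
      case (elim l)
      then obtain y where "?X l = ereal y" "\<bar>y + max_log\<bar> < e" by blast
      then show ?case by (simp only: real_of_ereal.simps dist_real_def diff_minus_eq_add)
    qed
  qed
  then have "(\<lambda>l. ereal (real_of_ereal (?X l))) \<longlonglongrightarrow> ereal (- max_log)" by simp
  ultimately show ?thesis by (subst tendsto_cong) 
qed

end

section \<open>From a finite cover number to the theorem\<close>

text \<open>Give the \<open>r\<close> sets of a finite cover equal weights: almost every point lies
  in at least one of them, so the combination is at least \<open>1 / r\<close> there.\<close>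

lemma (in set_system) covered_systemI:
  assumes "cover_number M I < \<infinity>"
  obtains u \<delta> where "covered_system M I u \<delta>"
proof -
  have "{r. 0 < r \<and> (\<exists>J::nat \<Rightarrow> 'a set. (\<forall>k<r. J k \<in> I) \<and> measure M (\<Union>k<r. J k) = 1)} \<noteq> {}"
    using assms unfolding cover_number_def by (auto simp: Inf_enat_def split: if_splits)
  then obtain r :: nat and J where r: "0 < r" "\<forall>k<r. J k \<in> I" "measure M (\<Union>k<r. J k) = 1" by auto
  define u where "u = (\<lambda>x. \<Sum>k<r. 1 / real r * indicator (J k) x)"
  have "u \<in> VP I"
    unfolding VP_def u_def using r
    by (intro CollectI exI[of _ r] exI[of _ "\<lambda>_. 1 / real r"] exI[of _ J]) auto
  moreover have "AE x in M. 1 / real r \<le> u x"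
  proof -
    have "AE x in M. x \<in> (\<Union>k<r. J k)"
      using r I by (intro prob_eq_1[THEN iffD1]) auto
    then show ?thesis
    proof eventually_elim
      case (elim x)
      then obtain k where k: "k < r" "x \<in> J k" by auto
      have "1 / real r * indicator (J k) x \<le> u x"
        unfolding u_def using k by (intro member_le_sum) auto
      then show ?case using k by simp
    qed
  qed
  ultimately have "covered_system M I u (1 / real r)"
    using r by unfold_locales auto
  then show thesis by (rule that)
qed

theorem theorem2p15:
  fixes M :: "'a measure" and I :: "'a set set"
  assumes "prob_space M"
    and "I \<subseteq> sets M"
    and "cover_number M I < \<infinity>"
  shows "\<exists>a \<in> VP_closure M I.
           (INF f\<in>VP I. phi M f) = phi M a
         \<and> (\<forall>b \<in> VP_closure M I. phi M a \<le> phi M b)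
         \<and> (\<forall>b \<in> VP_closure M I. phi M b = phi M a \<longrightarrow> (AE x in M. b x = a x))
         \<and> (reciprocal_in_L2 M a \<longrightarrow> has_entropy I M (phi M a))"
proof -
  interpret set_system M I
    using assms by (intro set_system.intro set_system_axioms.intro)
  obtain u \<delta> where "covered_system M I u \<delta>" using covered_systemI[OF assms(3)] .
  then interpret covered_system M I u \<delta> .
  obtain a where a: "a \<in> VP_closure M I" "log_integrable M a" "(\<integral>x. ln (a x) \<partial>M) = max_log"
    "\<And>x. 0 \<le> a x \<and> a x \<le> 1"
    using maximizer_exists by blast
  have phi: "phi M b = ereal (- (\<integral>x. ln (b x) \<partial>M))" if "b \<in> VP_closure M I" "log_integrable M b" for b
    using closure_bounds[OF that(1)] closure_measurable[OF that(1)] that(2)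
    by (intro phi_log_integrable) (auto elim!: eventually_mono)
  have phi_inf: "phi M b = \<infinity>" if "b \<in> VP_closure M I" "\<not> log_integrable M b" for b
    using closure_bounds[OF that(1)] closure_measurable[OF that(1)] that(2)
    by (intro phi_not_log_integrable) (auto elim!: eventually_mono)
  have phi_a: "phi M a = ereal (- max_log)" using phi[OF a(1,2)] a(3) by simp
  \<comment> \<open>Members of the closure that are not log-integrable have \<open>phi\<close>
    infinite, so only log-integrable competitors remain.\<close>
  have min: "phi M a \<le> phi M b" if "b \<in> VP_closure M I" for b
    using phi[OF that] phi_inf[OF that] closure_log_integral_le[OF that] phi_a
    by (cases "log_integrable M b") auto
  have "(INF f\<in>VP I. phi M f) = phi M a"
  proof (rule antisym)
    show "phi M a \<le> (INF f\<in>VP I. phi M f)"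
      using min VP_subset_closure by (intro INF_greatest) auto
    show "(INF f\<in>VP I. phi M f) \<le> phi M a"
    proof (rule ereal_le_epsilon2)
      fix e :: real assume "0 < e"
      then obtain f where f: "f \<in> VP I" "log_integrable M f" "max_log - e < (\<integral>x. ln (f x) \<partial>M)"
        using VP_log_integral_approx by blast
      have "(INF f\<in>VP I. phi M f) \<le> phi M f" by (rule INF_lower[OF f(1)])
      also have "\<dots> \<le> phi M a + ereal e"
        using f phi[OF subsetD[OF VP_subset_closure f(1)] f(2)] by (simp add: phi_a)
      finally show "(INF f\<in>VP I. phi M f) \<le> phi M a + ereal e" .
    qed
  qed
  moreover have "AE x in M. b x = a x" if b: "b \<in> VP_closure M I" "phi M b = phi M a" for b
  proof -
    \<comment> \<open>The minimum is finite, so a function attaining it must be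
      log-integrable.\<close>
    have lb: "log_integrable M b" using phi_inf[OF b(1)] b(2) phi_a by auto
    then have "(\<integral>x. ln (b x) \<partial>M) = max_log" using phi[OF b(1)] b(2) phi_a by simp
    then show ?thesis using maximizer_unique b(1) lb a by blast
  qed
  moreover have "has_entropy I M (phi M a)"
    unfolding has_entropy_def lower_entropy_def upper_entropy_def phi_a
    using log_box_cover_number_tendsto[OF a] by (auto intro: lim_imp_Liminf lim_imp_Limsup)
  ultimately show ?thesis using a(1) min by blast
qed

end
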